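(* Let $n$ be odd and let $q\in C^\infty(\mathbb R^n\setminus 0)$ be homogeneous of degree $d\in\mathbb Z$ with regular parity, i.e. $q(t\xi)=t^dq(\xi)$ for $t>0$ and $q(-\xi)=(-1)^dq(\xi)$. Then there is a unique homogeneous distribution with regular parity on $\mathbb R^n$ (homogeneous of degree $d$) which equals $q$ on $\mathbb R^n\setminus 0$.
   Context: A homogeneous distribution $u$ of degree $d$ on $\mathbb R^n$ has regular parity if $u(-\xi)=(-1)^du(\xi)$ in the sense of distributions on $\mathbb R^n$. *)

theory Defs
  imports "HOL-Analysis.Analysis"
begin

fun iter_partial :: "'n list \<Rightarrow> (real ^ 'n \<Rightarrow> complex) \<Rightarrow> real ^ 'n::finite \<Rightarrow> complex" where
  "iter_partial [] f = f"
| "iter_partial (i # is) f = (\<lambda>x. frechet_derivative (iter_partial is f) (at x) (axis i 1))"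

text \<open>
  For open \<open>S\<close> this is membership in \<open>C\<^sup>\<infinity>(S)\<close>: each iterated partial derivative is (totally)
  differentiable, so in particular all of them exist and are continuous. The junk values of
  \<^const>\<open>frechet_derivative\<close> outside \<open>S\<close> play no role, because differentiability at a point
  of \<open>S\<close> depends only on a neighbourhood of that point.
\<close>

definition smooth_on :: "(real ^ 'n) set \<Rightarrow> (real ^ 'n::finite \<Rightarrow> complex) \<Rightarrow> bool" where
  "smooth_on S f \<longleftrightarrow> (\<forall>is. \<forall>x\<in>S. iter_partial is f differentiable (at x))"

definition supp :: "(real ^ 'n::finite \<Rightarrow> complex) \<Rightarrow> (real ^ 'n) set" where
  "supp f = closure {x. f x \<noteq> 0}"

text \<open>
  \<open>C\<^sub>c\<^sup>\<infinity>(\<Omega>)\<close>, each element being extended by zero to the whole space.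
\<close>

definition test_functions :: "(real ^ 'n) set \<Rightarrow> (real ^ 'n::finite \<Rightarrow> complex) set" where
  "test_functions \<Omega> = {\<phi>. smooth_on UNIV \<phi> \<and> compact (supp \<phi>) \<and> supp \<phi> \<subseteq> \<Omega>}"

text \<open>
  Sum over the derivatives of order at most \<open>N\<close> of their sup norms. Lists enumerate multi-indices
  with repetition (by symmetry of the derivatives), which only changes the seminorm up to
  equivalence.
\<close>

definition Ck_seminorm :: "nat \<Rightarrow> (real ^ 'n::finite \<Rightarrow> complex) \<Rightarrow> real" where
  "Ck_seminorm N \<phi> = (\<Sum>is | length is \<le> N. SUP x. norm (iter_partial is \<phi> x))"

text \<open>
  Distributions on the whole space. Functions in HOL are total, so a functional on
  \<open>C\<^sub>c\<^sup>\<infinity>\<close> is taken to be extensional: its value on anything that is not a test function is fixed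
  to \<^const>\<open>undefined\<close>. Equality of distributions is then equality in HOL.
\<close>

definition distribution :: "((real ^ 'n::finite \<Rightarrow> complex) \<Rightarrow> complex) \<Rightarrow> bool" where
  "distribution u \<longleftrightarrow>
     u \<in> extensional (test_functions UNIV) \<and>
     (\<forall>\<phi>\<in>test_functions UNIV. \<forall>\<psi>\<in>test_functions UNIV. u (\<lambda>x. \<phi> x + \<psi> x) = u \<phi> + u \<psi>) \<and>
     (\<forall>\<phi>\<in>test_functions UNIV. \<forall>c. u (\<lambda>x. c * \<phi> x) = c * u \<phi>) \<and>
     (\<forall>K. compact K \<longrightarrow>
        (\<exists>C N. \<forall>\<phi>\<in>test_functions UNIV. supp \<phi> \<subseteq> K \<longrightarrow> norm (u \<phi>) \<le> C * Ck_seminorm N \<phi>))"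

text \<open>
  The distribution \<open>u(t\<xi>)\<close> for real \<open>t \<noteq> 0\<close>, i.e. the pullback of \<open>u\<close> under \<open>\<xi> \<mapsto> t\<xi>\<close>; the
  formula is the change of variables \<open>\<integral> u(t\<xi>) \<phi>(\<xi>) d\<xi> = \<bar>t\<bar>\<^sup>-\<^sup>n \<integral> u(\<xi>) \<phi>(\<xi>/t) d\<xi>\<close>.
\<close>

definition dist_dilate ::
  "real \<Rightarrow> ((real ^ 'n::finite \<Rightarrow> complex) \<Rightarrow> complex) \<Rightarrow> (real ^ 'n \<Rightarrow> complex) \<Rightarrow> complex" where
  "dist_dilate t u \<phi> = u (\<lambda>\<xi>. \<phi> (inverse t *\<^sub>R \<xi>)) / of_real (\<bar>t\<bar> ^ CARD('n))"

definition homogeneous_dist ::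
  "int \<Rightarrow> ((real ^ 'n::finite \<Rightarrow> complex) \<Rightarrow> complex) \<Rightarrow> bool" where
  "homogeneous_dist d u \<longleftrightarrow>
     (\<forall>t>0. \<forall>\<phi>\<in>test_functions UNIV. dist_dilate t u \<phi> = of_real (t powi d) * u \<phi>)"

definition regular_parity ::
  "int \<Rightarrow> ((real ^ 'n::finite \<Rightarrow> complex) \<Rightarrow> complex) \<Rightarrow> bool" where
  "regular_parity d u \<longleftrightarrow>
     (\<forall>\<phi>\<in>test_functions UNIV. dist_dilate (-1) u \<phi> = (-1) powi d * u \<phi>)"

definition dist_equals_on ::
  "(real ^ 'n) set \<Rightarrow> ((real ^ 'n::finite \<Rightarrow> complex) \<Rightarrow> complex) \<Rightarrow> (real ^ 'n \<Rightarrow> complex) \<Rightarrow> bool" where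
  "dist_equals_on \<Omega> u q \<longleftrightarrow> (\<forall>\<phi>\<in>test_functions \<Omega>. u \<phi> = (\<integral>\<xi>. q \<xi> * \<phi> \<xi> \<partial>lborel))"

end

theory Submission
  imports Defs
begin

text \<open>
  Existence. Put \<open>N = - d - n\<close> and let \<open>R\<phi>\<close> be \<open>\<phi>\<close> minus its Taylor polynomial at \<open>0\<close> of
  degree \<open>< N\<close>, symmetrised as \<open>R\<phi>(x) + (-1)\<^sup>d R\<phi>(-x)\<close>. Since \<open>n\<close> is odd, the Taylor part of degree
  \<open>N\<close> cancels in the symmetrisation, so that \<open>q R\<phi> = O(\<bar>x\<bar>\<^sup>1\<^sup>-\<^sup>n)\<close> near \<open>0\<close>, and
  \<open>q R\<phi> = O(\<bar>x\<bar>\<^sup>-\<^sup>n\<^sup>-\<^sup>1)\<close> at infinity. Hence \<open>\<phi> \<mapsto> \<integral> q R\<phi> / 2\<close> converges absolutely without any cutoff,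
  and homogeneity is a change of variables because Taylor polynomials commute with dilations.

  Uniqueness. The difference \<open>v\<close> of two extensions is supported at \<open>0\<close>, so it annihilates test
  functions that are flat at \<open>0\<close> to high order. The degree of flatness required is then lowered
  step by step by testing against \<open>\<phi>(s x) - s\<^sup>j \<phi>(x)\<close>.
\<close>

subsection \<open>Smooth functions and test functions\<close>

lemma frechet_derivative_eqI:
  "(f has_derivative f') (at x) \<Longrightarrow> frechet_derivative f (at x) = f'"
  using frechet_derivative_at by metis

lemma iter_partial_append: "iter_partial (is @ js) f = iter_partial is (iter_partial js f)"
  by (induction "is") auto

lemma smooth_onD_has_derivative:
  "smooth_on UNIV f \<Longrightarrow>
    (iter_partial is f has_derivative frechet_derivative (iter_partial is f) (at x)) (at x)"
  by (auto simp: smooth_on_def frechet_derivative_works[symmetric])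

lemma smooth_on_iter_partial: "smooth_on S f \<Longrightarrow> smooth_on S (iter_partial is f)"
  by (auto simp: smooth_on_def iter_partial_append[symmetric])

lemma continuous_on_iter_partial: "smooth_on S f \<Longrightarrow> continuous_on S (iter_partial is f)"
  by (intro continuous_at_imp_continuous_on ballI differentiable_imp_continuous_within)
     (auto simp: smooth_on_def)

lemma iter_partial_add:
  assumes "smooth_on UNIV f" "smooth_on UNIV g"
  shows "iter_partial is (\<lambda>x. f x + g x) = (\<lambda>x. iter_partial is f x + iter_partial is g x)"
proof (induction "is")
  case (Cons i "is")
  show ?case
    using frechet_derivative_eqI[OF has_derivative_add[OF
        smooth_onD_has_derivative[OF assms(1), of "is"] smooth_onD_has_derivative[OF assms(2), of "is"]]]
    by (simp add: Cons.IH)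
qed simp

lemma iter_partial_cmult:
  assumes "smooth_on UNIV f"
  shows "iter_partial is (\<lambda>x. c * f x) = (\<lambda>x. c * iter_partial is f x)"
proof (induction "is")
  case (Cons i "is")
  show ?case
    using frechet_derivative_eqI[OF has_derivative_mult_right[OF
        smooth_onD_has_derivative[OF assms(1), of "is"], of c]]
    by (simp add: Cons.IH)
qed simp

text \<open>The factor \<open>c\<close> and the list \<open>is\<close> are carried along because
  every partial derivative of a dilated function is again a power of \<open>s\<close> times a
  dilated derivative. One statement thus serves each stage of the induction on the order and the
  differentiability of the result.\<close>

lemma has_derivative_dilate:
  fixes f :: "real ^ 'n::finite \<Rightarrow> complex"
  assumes "smooth_on UNIV f"
  shows "((\<lambda>x. c * iter_partial is f (s *\<^sub>R x)) has_derivative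
    (\<lambda>h. c * frechet_derivative (iter_partial is f) (at (s *\<^sub>R x)) (s *\<^sub>R h))) (at x)"
proof -
  have "((\<lambda>x. s *\<^sub>R x) has_derivative (\<lambda>h. s *\<^sub>R h)) (at x)"
    by (auto intro!: derivative_eq_intros)
  then have "(iter_partial is f \<circ> (\<lambda>x. s *\<^sub>R x) has_derivative
      frechet_derivative (iter_partial is f) (at (s *\<^sub>R x)) \<circ> (\<lambda>h. s *\<^sub>R h)) (at x)"
    by (rule diff_chain_at) (rule smooth_onD_has_derivative[OF assms])
  then show ?thesis
    by (auto simp: o_def intro: has_derivative_mult_right)
qed

lemma iter_partial_dilate:
  fixes f :: "real ^ 'n::finite \<Rightarrow> complex"
  assumes "smooth_on UNIV f"
  shows "iter_partial is (\<lambda>x. f (s *\<^sub>R x)) =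
    (\<lambda>x. of_real (s ^ length is) * iter_partial is f (s *\<^sub>R x))"
proof (induction "is")
  case (Cons i "is")
  have lin: "linear (frechet_derivative (iter_partial is f) (at y))" for y
    using smooth_onD_has_derivative[OF assms] by (rule has_derivative_linear)
  show ?case
  proof
    fix x
    have "iter_partial (i # is) (\<lambda>x. f (s *\<^sub>R x)) x = of_real (s ^ length is) *
        frechet_derivative (iter_partial is f) (at (s *\<^sub>R x)) (s *\<^sub>R axis i 1)"
      unfolding iter_partial.simps Cons.IH frechet_derivative_eqI[OF has_derivative_dilate[OF assms]] ..
    also have "\<dots> = of_real (s ^ length (i # is)) * iter_partial (i # is) f (s *\<^sub>R x)"
      unfolding linear_scale[OF lin] by (simp add: scaleR_conv_of_real[where 'a = complex])
    finally show "iter_partial (i # is) (\<lambda>x. f (s *\<^sub>R x)) x = \<dots>" .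
  qed
qed simp

lemma smooth_on_add:
  assumes "smooth_on UNIV f" "smooth_on UNIV g"
  shows "smooth_on UNIV (\<lambda>x. f x + g x)"
  using assms unfolding smooth_on_def iter_partial_add[OF assms] by auto

lemma smooth_on_cmult:
  assumes "smooth_on UNIV f"
  shows "smooth_on UNIV (\<lambda>x. c * f x)"
  using assms unfolding smooth_on_def iter_partial_cmult[OF assms] by (auto intro: differentiable_mult)

lemma smooth_on_dilate:
  assumes "smooth_on UNIV f"
  shows "smooth_on UNIV (\<lambda>x. f (s *\<^sub>R x))"
  unfolding smooth_on_def iter_partial_dilate[OF assms] differentiable_def
  using has_derivative_dilate[OF assms] by blast

lemma compact_supp_subset: "compact K \<Longrightarrow> supp f \<subseteq> K \<Longrightarrow> compact (supp f)"
  unfolding compact_eq_bounded_closed supp_def using bounded_subset closed_closure by blast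

lemma test_functions_add:
  assumes "f \<in> test_functions S" "g \<in> test_functions S"
  shows "(\<lambda>x. f x + g x) \<in> test_functions S"
proof -
  have *: "supp (\<lambda>x. f x + g x) \<subseteq> supp f \<union> supp g"
    unfolding supp_def closure_Un[symmetric] by (rule closure_mono) auto
  have "compact (supp (\<lambda>x. f x + g x))"
    by (rule compact_supp_subset[OF _ *]) (use assms in \<open>auto simp: test_functions_def\<close>)
  then show ?thesis
    using assms * by (auto simp: test_functions_def smooth_on_add)
qed

lemma test_functions_cmult:
  assumes "f \<in> test_functions S"
  shows "(\<lambda>x. c * f x) \<in> test_functions S"
proof -
  have *: "supp (\<lambda>x. c * f x) \<subseteq> supp f"
    unfolding supp_def by (rule closure_mono) auto
  have "compact (supp (\<lambda>x. c * f x))"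
    by (rule compact_supp_subset[OF _ *]) (use assms in \<open>auto simp: test_functions_def\<close>)
  then show ?thesis
    using assms * by (auto simp: test_functions_def smooth_on_cmult)
qed

lemma test_functions_dilate:
  assumes "f \<in> test_functions UNIV" "s \<noteq> 0"
  shows "(\<lambda>x. f (s *\<^sub>R x)) \<in> test_functions UNIV"
proof -
  have "{x. f (s *\<^sub>R x) \<noteq> 0} \<subseteq> (\<lambda>x. inverse s *\<^sub>R x) ` supp f"
  proof
    fix x assume "x \<in> {x. f (s *\<^sub>R x) \<noteq> 0}"
    then have "s *\<^sub>R x \<in> supp f"
      using closure_subset by (fastforce simp: supp_def)
    then show "x \<in> (\<lambda>x. inverse s *\<^sub>R x) ` supp f"
      using assms(2) by (auto intro!: image_eqI[of _ _ "s *\<^sub>R x"])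
  qed
  moreover have "compact ((\<lambda>x. inverse s *\<^sub>R x) ` supp f)"
    using assms by (intro compact_scaling) (auto simp: test_functions_def)
  ultimately have "compact (supp (\<lambda>x. f (s *\<^sub>R x)))"
    unfolding supp_def by (meson compact_closure bounded_subset compact_imp_bounded)
  then show ?thesis
    using assms by (auto simp: test_functions_def smooth_on_dilate)
qed

text \<open>The complement of the support is open, so at each stage of the induction the function is
  locally zero there. With the empty list this is the usual \<open>f x = 0\<close> off the
  support.\<close>

lemma iter_partial_outside_supp: "x \<notin> supp f \<Longrightarrow> iter_partial is f x = 0"
proof (induction "is" arbitrary: x)
  case Nil
  then show ?case using closure_subset[of "{x. f x \<noteq> 0}"] by (auto simp: supp_def)
next
  case (Cons i "is")
  have "(iter_partial is f has_derivative (\<lambda>_. 0)) (at x)"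
    by (rule has_derivative_transform_within_open[of "\<lambda>_. 0" _ _ UNIV "- supp f"])
       (use Cons in \<open>auto simp: supp_def\<close>)
  from frechet_derivative_eqI[OF this] show ?case by simp
qed

lemma supp_iter_partial: "supp (iter_partial is f) \<subseteq> supp f"
  using iter_partial_outside_supp[of _ f "is"]
  unfolding supp_def[of "iter_partial is f"]
  by (intro closure_minimal) (auto simp: supp_def)

lemma test_functions_iter_partial:
  assumes "f \<in> test_functions S" shows "iter_partial is f \<in> test_functions S"
proof -
  have "compact (supp (iter_partial is f))"
    by (rule compact_supp_subset[OF _ supp_iter_partial])
       (use assms in \<open>auto simp: test_functions_def\<close>)
  then show ?thesis
    using assms supp_iter_partial[of "is" f] by (auto simp: test_functions_def smooth_on_iter_partial)
qed

section \<open>Boundedness of test functions and the seminorms\<close>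

lemma test_functions_bounded:
  assumes "f \<in> test_functions UNIV"
  shows "bdd_above (range (\<lambda>x. norm (f x)))"
proof -
  have "compact (f ` supp f)"
    using assms continuous_on_iter_partial[of UNIV f "[]"]
    by (intro compact_continuous_image) (auto simp: test_functions_def intro: continuous_on_subset)
  then obtain B where B: "\<And>x. x \<in> supp f \<Longrightarrow> norm (f x) \<le> B"
    unfolding compact_eq_bounded_closed bounded_iff by blast
  have "norm (f x) \<le> max 0 B" for x
    using B[of x] iter_partial_outside_supp[of x f "[]"] by (cases "x \<in> supp f") auto
  then show ?thesis by (intro bdd_aboveI[of _ "max 0 B"]) auto
qed

lemma finite_lists_le: "finite {is :: 'n::finite list. length is \<le> N}"
  using finite_lists_length_le[of "UNIV :: 'n set" N] by simp

text \<open>A real \<open>SUP\<close> is meaningful only over a set bounded above. Compact support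
  ensures this for every derivative, so that no summand of the seminorm is negative and each is
  dominated by the whole sum.\<close>

lemma iter_partial_le_Ck_seminorm:
  assumes "f \<in> test_functions UNIV" "length is \<le> N"
  shows "norm (iter_partial is f x) \<le> Ck_seminorm N f"
proof -
  have bdd: "bdd_above (range (\<lambda>x. norm (iter_partial js f x)))" for js
    by (rule test_functions_bounded[OF test_functions_iter_partial[OF assms(1)]])
  have "norm (iter_partial is f x) \<le> (SUP x. norm (iter_partial is f x))"
    by (rule cSUP_upper[OF _ bdd]) simp
  also have "\<dots> \<le> Ck_seminorm N f"
    unfolding Ck_seminorm_def
  proof (rule member_le_sum)
    show "0 \<le> (SUP x. norm (iter_partial js f x))" for js
      by (rule cSUP_upper2[OF bdd UNIV_I[of 0]]) simp
  qed (use assms finite_lists_le in auto)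
  finally show ?thesis .
qed

lemma Ck_seminorm_nonneg: "f \<in> test_functions UNIV \<Longrightarrow> 0 \<le> Ck_seminorm N f"
  by (rule order_trans[OF norm_ge_zero iter_partial_le_Ck_seminorm[of f "[]"]]) auto

lemma Ck_seminorm_mono:
  assumes "f \<in> test_functions UNIV" "M \<le> N"
  shows "Ck_seminorm M f \<le> Ck_seminorm N f"
  unfolding Ck_seminorm_def
proof (rule sum_mono2)
  show "0 \<le> (SUP x. norm (iter_partial js f x))" for js
    by (rule cSUP_upper2[OF test_functions_bounded[OF test_functions_iter_partial[OF assms(1)]] UNIV_I[of 0]])
       simp
qed (use assms finite_lists_le in auto)

subsection \<open>Taylor expansion at the origin\<close>

text \<open>For smooth \<open>f\<close>, a multi-index alpha of order \<open>k\<close> is met by k!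
  / alpha! lists, so the division by \<open>fact k\<close> leaves the usual homogeneous part of
  degree \<open>k\<close> with coefficients 1 / alpha!.\<close>

definition taylor_part :: "nat \<Rightarrow> (real ^ 'n::finite \<Rightarrow> complex) \<Rightarrow> real ^ 'n \<Rightarrow> complex" where
  "taylor_part k f x =
     (\<Sum>is | length is = k. of_real (\<Prod>i\<leftarrow>is. x $ i) * iter_partial is f 0) / fact k"

lemma taylor_part_add:
  "smooth_on UNIV f \<Longrightarrow> smooth_on UNIV g \<Longrightarrow>
    taylor_part k (\<lambda>x. f x + g x) x = taylor_part k f x + taylor_part k g x"
  by (simp add: taylor_part_def iter_partial_add sum.distrib distrib_left add_divide_distrib)

lemma taylor_part_cmult:
  "smooth_on UNIV f \<Longrightarrow> taylor_part k (\<lambda>x. c * f x) x = c * taylor_part k f x"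
  by (simp add: taylor_part_def iter_partial_cmult sum_distrib_left mult_ac)

lemma prod_list_scaleR_nth: "(\<Prod>i\<leftarrow>is. (s *\<^sub>R x) $ i) = s ^ length is * (\<Prod>i\<leftarrow>is. x $ i)"
  by (induction "is") auto

lemma taylor_part_dilate:
  "smooth_on UNIV f \<Longrightarrow> taylor_part k (\<lambda>x. f (s *\<^sub>R x)) x = taylor_part k f (s *\<^sub>R x)"
  unfolding taylor_part_def prod_list_scaleR_nth
  by (auto simp: iter_partial_dilate mult_ac intro!: arg_cong2[of _ _ _ _ "(/)"] sum.cong)

lemma taylor_part_scaleR: "taylor_part k f (s *\<^sub>R x) = of_real (s ^ k) * taylor_part k f x"
  unfolding taylor_part_def prod_list_scaleR_nth
  by (auto simp: sum_distrib_left mult_ac intro!: arg_cong2[of _ _ _ _ "(/)"] sum.cong)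

lemma abs_prod_list_nth_le: "\<bar>\<Prod>i\<leftarrow>is. x $ i\<bar> \<le> norm x ^ length is"
  for x :: "real ^ 'n::finite"
  by (induction "is") (auto simp: abs_mult component_le_norm_cart intro!: mult_mono)

text \<open>There are \<open>CARD('n) ^ k\<close> lists of length \<open>k\<close>, and each
  monomial is at most \<open>norm x ^ k\<close>. The coefficients \<open>g\<close> stay general
  because they are derivatives at \<open>0\<close> in a Taylor part but derivatives along a ray in
  the remainder.\<close>

lemma norm_sum_lists_le:
  fixes g :: "'n::finite list \<Rightarrow> complex" and x :: "real ^ 'n"
  assumes "\<And>is. length is = k \<Longrightarrow> norm (g is) \<le> C"
  shows "norm (\<Sum>is | length is = k. of_real (\<Prod>i\<leftarrow>is. x $ i) * g is) \<le> real CARD('n) ^ k * C * norm x ^ k"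
proof -
  have "norm (\<Sum>is | length is = k. of_real (\<Prod>i\<leftarrow>is. x $ i) * g is)
      \<le> of_nat (card {is :: 'n list. length is = k}) * (norm x ^ k * C)"
    by (rule sum_norm_bound)
       (use assms abs_prod_list_nth_le[of x] in \<open>auto simp: norm_mult intro!: mult_mono\<close>)
  also have "card {is :: 'n list. length is = k} = CARD('n) ^ k"
    using card_lists_length_eq[of "UNIV :: 'n set" k] by simp
  finally show ?thesis by (simp add: mult_ac)
qed

lemma taylor_part_bound:
  fixes f :: "real ^ 'n::finite \<Rightarrow> complex"
  assumes "\<And>is. length is = k \<Longrightarrow> norm (iter_partial is f 0) \<le> C"
  shows "norm (taylor_part k f x) \<le> real CARD('n) ^ k * C * norm x ^ k"
proof -
  have "norm (taylor_part k f x) =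
      norm (\<Sum>is | length is = k. of_real (\<Prod>i\<leftarrow>is. x $ i) * iter_partial is f 0) / fact k"
    by (simp add: taylor_part_def norm_divide)
  also have "\<dots> \<le> norm (\<Sum>is | length is = k. of_real (\<Prod>i\<leftarrow>is. x $ i) * iter_partial is f 0) / 1"
    by (intro divide_left_mono) auto
  also have "\<dots> \<le> real CARD('n) ^ k * C * norm x ^ k"
    using norm_sum_lists_le[OF assms] by simp
  finally show ?thesis .
qed

lemma sum_lists_Suc:
  fixes g :: "'n::finite list \<Rightarrow> complex"
  shows "(\<Sum>is | length is = Suc k. g is) = (\<Sum>is | length is = k. \<Sum>i\<in>UNIV. g (i # is))"
proof -
  have "{is :: 'n list. length is = Suc k} = (\<lambda>(is, i). i # is) ` ({is. length is = k} \<times> UNIV)"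
    by (auto simp: length_Suc_conv image_iff)
  then show ?thesis
    by (simp add: sum.cartesian_product sum.reindex inj_on_def case_prod_unfold)
qed

text \<open>The sum of order \<open>k\<close> is the \<open>k\<close>-th derivative of
  \<open>f (t *\<^sub>R x)\<close> in \<open>t\<close>. By the chain rule, with \<open>x\<close>
  expanded in the standard basis, one more differentiation prepends one index to each list.\<close>

lemma has_vector_derivative_along_ray:
  fixes f :: "real ^ 'n::finite \<Rightarrow> complex"
  assumes "smooth_on UNIV f"
  shows "((\<lambda>t. \<Sum>is | length is = k. of_real (\<Prod>i\<leftarrow>is. x $ i) * iter_partial is f (t *\<^sub>R x))
    has_vector_derivative
      (\<Sum>is | length is = Suc k. of_real (\<Prod>i\<leftarrow>is. x $ i) * iter_partial is f (t *\<^sub>R x))) (at t within S)"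
proof -
  have *: "((\<lambda>t. iter_partial is f (t *\<^sub>R x)) has_vector_derivative
      (\<Sum>i\<in>UNIV. of_real (x $ i) * iter_partial (i # is) f (t *\<^sub>R x))) (at t within S)" for "is"
  proof -
    let ?D = "frechet_derivative (iter_partial is f) (at (t *\<^sub>R x))"
    have D: "(iter_partial is f has_derivative ?D) (at (t *\<^sub>R x))"
      by (rule smooth_onD_has_derivative[OF assms])
    have "((\<lambda>t. t *\<^sub>R x) has_vector_derivative x) (at t within S)"
      by (auto intro!: derivative_eq_intros)
    then have "((\<lambda>t. iter_partial is f (t *\<^sub>R x)) has_vector_derivative ?D x) (at t within S)"
      using vector_derivative_diff_chain_within[of "\<lambda>t. t *\<^sub>R x" x t S "iter_partial is f" ?D]
        has_derivative_at_withinI[OF D] by (simp add: o_def)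
    moreover have "?D x = ?D (\<Sum>i\<in>UNIV. (x $ i) *\<^sub>R axis i 1)"
      using basis_expansion[of x] by (simp add: scalar_mult_eq_scaleR)
    moreover have "\<dots> = (\<Sum>i\<in>UNIV. (x $ i) *\<^sub>R ?D (axis i 1))"
      using has_derivative_linear[OF D] by (simp add: linear_sum linear_scale)
    ultimately show ?thesis by (simp add: scaleR_conv_of_real)
  qed
  have "((\<lambda>t. \<Sum>is | length is = k. of_real (\<Prod>i\<leftarrow>is. x $ i) * iter_partial is f (t *\<^sub>R x))
    has_vector_derivative
      (\<Sum>is | length is = k. of_real (\<Prod>i\<leftarrow>is. x $ i) *
        (\<Sum>i\<in>UNIV. of_real (x $ i) * iter_partial (i # is) f (t *\<^sub>R x)))) (at t within S)"
    by (intro has_vector_derivative_sum has_vector_derivative_mult_right *)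
  then show ?thesis
    by (simp add: sum_lists_Suc sum_distrib_left mult_ac)
qed

text \<open>This is the one-dimensional Taylor formula with integral remainder, applied along the
  segment from \<open>0\<close> to \<open>x\<close>; its kernel is at most \<open>1\<close> on the
  unit interval. The integral formula requires a positive order, hence the separate case
  \<open>m = 0\<close>.\<close>

lemma taylor_remainder_bound:
  fixes f :: "real ^ 'n::finite \<Rightarrow> complex"
  assumes "smooth_on UNIV f"
    and C: "\<And>is x. length is = m \<Longrightarrow> norm (iter_partial is f x) \<le> C"
  shows "norm (f x - (\<Sum>k<m. taylor_part k f x)) \<le> real CARD('n) ^ m * C * norm x ^ m"
proof (cases "m = 0")
  case True
  then show ?thesis using C[of "[]" x] by simp
next
  case False
  define G where "G k t = (\<Sum>is | length is = k. of_real (\<Prod>i\<leftarrow>is. x $ i) * iter_partial is f (t *\<^sub>R x))"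
    for k t
  have G0: "G 0 t = f (t *\<^sub>R x)" for t
    by (simp add: G_def)
  have Gk: "G k 0 /\<^sub>R fact k = taylor_part k f x" for k
    by (simp add: G_def taylor_part_def scaleR_conv_of_real field_simps)
  have I: "((\<lambda>t. ((1 - t) ^ (m - 1) / fact (m - 1)) *\<^sub>R G m t) has_integral
      G 0 1 - (\<Sum>i<m. ((1 - 0) ^ i / fact i) *\<^sub>R G i 0)) {0..1}"
    by (rule Taylor_has_integral)
       (use False in \<open>auto simp: G_def intro!: has_vector_derivative_along_ray assms(1)\<close>)
  have G_le: "norm (G m t) \<le> real CARD('n) ^ m * C * norm x ^ m" for t
    unfolding G_def by (rule norm_sum_lists_le) (rule C)
  have "\<bar>(1 - t) ^ (m - 1) / fact (m - 1)\<bar> \<le> 1" if "t \<in> {0..1}" for t :: real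
    using that by (auto simp: abs_if field_simps intro: order_trans[OF power_le_one])
  then have "norm (((1 - t) ^ (m - 1) / fact (m - 1)) *\<^sub>R G m t) \<le> 1 * (real CARD('n) ^ m * C * norm x ^ m)"
    if "t \<in> {0..1}" for t
    using that unfolding norm_scaleR by (intro mult_mono G_le) auto
  moreover have "0 \<le> 1 * (real CARD('n) ^ m * C * norm x ^ m)"
    using order_trans[OF norm_ge_zero G_le[of 0]] by simp
  ultimately have "norm (G 0 1 - (\<Sum>i<m. ((1 - 0) ^ i / fact i) *\<^sub>R G i 0))
      \<le> 1 * (real CARD('n) ^ m * C * norm x ^ m) * measure lborel {0..1::real}"
    by (intro has_integral_bound_real[OF _ finite.emptyI I]) auto
  then show ?thesis
    using Gk by (simp add: G0 inverse_eq_divide)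
qed

subsection \<open>A smooth cutoff function\<close>

text \<open>These are the functions exp(-1/t) / t^m, extended by zero to t <= 0. The family is
  chosen so that its linear span is closed under differentiation and contains exp(-1/t).\<close>

definition flat_exp :: "nat \<Rightarrow> real \<Rightarrow> real" where
  "flat_exp m t = (if t > 0 then exp (- inverse t) * inverse t ^ m else 0)"

lemma tendsto_flat_exp_0: "(flat_exp m \<longlongrightarrow> 0) (at 0)"
proof (rule filterlim_split_at)
  show "(flat_exp m \<longlongrightarrow> 0) (at_left 0)"
    by (rule tendsto_eventually) (auto simp: eventually_at_filter flat_exp_def)
  have "((\<lambda>x::real. x ^ m / exp x) \<longlongrightarrow> 0) at_top"
    by (rule tendsto_power_div_exp_0)
  from filterlim_compose[OF this filterlim_inverse_at_top_right]
  show "(flat_exp m \<longlongrightarrow> 0) (at_right 0)"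
    by (rule Lim_transform_eventually)
       (auto simp: eventually_at_filter flat_exp_def exp_minus field_simps)
qed

lemma has_real_derivative_flat_exp:
  "(flat_exp m has_real_derivative flat_exp (m + 2) t - m * flat_exp (m + 1) t) (at t)"
proof -
  consider "t > 0" | "t < 0" | "t = 0" by linarith
  then show ?thesis
  proof cases
    case 1
    define y where "y = inverse t"
    have "((\<lambda>t. exp (- inverse t) * inverse t ^ m) has_real_derivative
        exp (- y) * (y * y) * y ^ m + m * (- (y * y)) * y ^ (m - 1) * exp (- y)) (at t)"
      using 1 by (auto intro!: derivative_eq_intros simp: y_def algebra_simps)
    \<comment> \<open>The case split on \<open>m\<close> takes care of the truncated exponent
      \<open>m - 1\<close>.\<close>
    moreover have "exp (- y) * (y * y) * y ^ m + m * (- (y * y)) * y ^ (m - 1) * exp (- y) =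
        flat_exp (m + 2) t - m * flat_exp (m + 1) t"
      using 1 by (cases m) (simp_all add: flat_exp_def y_def)
    ultimately have "((\<lambda>t. exp (- inverse t) * inverse t ^ m) has_real_derivative
        flat_exp (m + 2) t - m * flat_exp (m + 1) t) (at t)" by simp
    then show ?thesis
      by (rule has_field_derivative_transform_within_open[of _ _ _ "{0<..}"]) (use 1 in \<open>auto simp: flat_exp_def\<close>)
  next
    case 2
    have "((\<lambda>t. 0) has_real_derivative flat_exp (m + 2) t - m * flat_exp (m + 1) t) (at t)"
      using 2 by (simp add: flat_exp_def)
    then show ?thesis
      by (rule has_field_derivative_transform_within_open[of _ _ _ "{..<0}"]) (use 2 in \<open>auto simp: flat_exp_def\<close>)
  next
    case 3
    \<comment> \<open>For \<open>h \<noteq> 0\<close> the difference quotient at the origin is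
      \<open>flat_exp (m + 1) h\<close>, so the limit already established gives derivative
      zero.\<close>
    have "((\<lambda>h. (flat_exp m (0 + h) - flat_exp m 0) / h) \<longlongrightarrow> 0) (at 0)"
      by (rule Lim_transform_eventually[OF tendsto_flat_exp_0[of "m + 1"]])
         (auto simp: eventually_at_filter flat_exp_def field_simps)
    then show ?thesis
      using 3 by (simp add: DERIV_def flat_exp_def)
  qed
qed

text \<open>
  An algebra of functions closed under partial derivatives, hence consisting of smooth functions.
  It is closed under composition with \<open>exp (-1 / t)\<close>, which makes division unnecessary for building
  a cutoff.
\<close>

inductive_set elementary :: "(real ^ 'n::finite \<Rightarrow> real) set" where
  const: "(\<lambda>_. c) \<in> elementary"
| coord: "(\<lambda>x. x $ i) \<in> elementary"
| add: "f \<in> elementary \<Longrightarrow> g \<in> elementary \<Longrightarrow> (\<lambda>x. f x + g x) \<in> elementary"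
| mult: "f \<in> elementary \<Longrightarrow> g \<in> elementary \<Longrightarrow> (\<lambda>x. f x * g x) \<in> elementary"
| flat: "f \<in> elementary \<Longrightarrow> (\<lambda>x. flat_exp m (f x)) \<in> elementary"

lemma elementary_sum:
  "finite I \<Longrightarrow> (\<And>i. i \<in> I \<Longrightarrow> f i \<in> elementary) \<Longrightarrow> (\<lambda>x. \<Sum>i\<in>I. f i x) \<in> elementary"
  by (induction I rule: finite_induct) (auto intro: elementary.intros)

lemma elementary_has_derivative:
  assumes "f \<in> elementary"
  shows "\<exists>f'. (\<forall>x. (f has_derivative f' x) (at x)) \<and> (\<forall>i. (\<lambda>x. f' x (axis i 1)) \<in> elementary)"
  using assms
proof induction
  case (const c)
  then show ?case by (intro exI[of _ "\<lambda>x h. 0"]) (auto intro: elementary.intros)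
next
  case (coord i)
  have "((\<lambda>x. x $ i) has_derivative (\<lambda>h. h $ i)) (at x)" for x :: "real ^ 'a"
    by (rule bounded_linear_imp_has_derivative[OF bounded_linear_vec_nth])
  then show ?case
    by (intro exI[of _ "\<lambda>x h. h $ i"]) (auto intro: elementary.intros)
next
  case (add f g)
  then obtain f' g' where "\<And>x. (f has_derivative f' x) (at x)" "\<And>i. (\<lambda>x. f' x (axis i 1)) \<in> elementary"
    "\<And>x. (g has_derivative g' x) (at x)" "\<And>i. (\<lambda>x. g' x (axis i 1)) \<in> elementary" by blast
  then show ?case
    by (intro exI[of _ "\<lambda>x h. f' x h + g' x h"]) (auto intro: elementary.intros has_derivative_add)
next
  case (mult f g)
  then obtain f' g' where "\<And>x. (f has_derivative f' x) (at x)" "\<And>i. (\<lambda>x. f' x (axis i 1)) \<in> elementary"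
    "\<And>x. (g has_derivative g' x) (at x)" "\<And>i. (\<lambda>x. g' x (axis i 1)) \<in> elementary" by blast
  then show ?case
    by (intro exI[of _ "\<lambda>x h. f x * g' x h + f' x h * g x"])
       (auto intro!: elementary.intros has_derivative_mult mult.hyps)
next
  case (flat f m)
  then obtain f' where f': "\<And>x. (f has_derivative f' x) (at x)" "\<And>i. (\<lambda>x. f' x (axis i 1)) \<in> elementary"
    by blast
  \<comment> \<open>The difference is written as a sum with a constant factor so that it matches the
    closure rules of \<open>elementary\<close>.\<close>
  let ?D = "\<lambda>x. flat_exp (m + 2) (f x) + (- real m) * flat_exp (m + 1) (f x)"
  have "((\<lambda>x. flat_exp m (f x)) has_derivative (\<lambda>h. ?D x * f' x h)) (at x)" for x
    using DERIV_compose_FDERIV[OF has_real_derivative_flat_exp f'(1)] by (simp add: mult_ac)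
  moreover have "(\<lambda>x. ?D x * f' x (axis i 1)) \<in> elementary" for i
    by (intro elementary.intros f' flat.hyps)
  ultimately show ?case by (intro exI[of _ "\<lambda>x h. ?D x * f' x h"]) simp
qed

lemma elementary_smooth_on:
  assumes "f \<in> elementary"
  shows "smooth_on UNIV (\<lambda>x. complex_of_real (f x))"
proof -
  have ex: "\<exists>g\<in>elementary. iter_partial is (\<lambda>x. complex_of_real (f x)) = (\<lambda>x. complex_of_real (g x))" for "is"
  proof (induction "is")
    case Nil
    then show ?case using assms by auto
  next
    case (Cons i "is")
    then obtain g where g: "g \<in> elementary"
      "iter_partial is (\<lambda>x. complex_of_real (f x)) = (\<lambda>x. complex_of_real (g x))" by blast
    obtain g' where g': "\<And>x. (g has_derivative g' x) (at x)" "\<And>i. (\<lambda>x. g' x (axis i 1)) \<in> elementary"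
      using elementary_has_derivative[OF g(1)] by blast
    have "iter_partial (i # is) (\<lambda>x. complex_of_real (f x)) = (\<lambda>x. complex_of_real (g' x (axis i 1)))"
    proof -
      have "((\<lambda>x. complex_of_real (g x)) has_derivative (\<lambda>h. complex_of_real (g' x h))) (at x)" for x
        using g'(1) by (rule has_derivative_of_real)
      from frechet_derivative_eqI[OF this] show ?thesis by (simp add: g(2))
    qed
    then show ?case using g'(2)[of i] by (auto intro!: bexI[of _ "\<lambda>x. g' x (axis i 1)"])
  qed
  have diff: "(\<lambda>x. complex_of_real (g x)) differentiable (at x)" if "g \<in> elementary" for g x
    using elementary_has_derivative[OF that] has_derivative_of_real
    unfolding differentiable_def by blast
  show ?thesis
    unfolding smooth_on_def
  proof (intro allI ballI)
    fix "is" x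
    show "iter_partial is (\<lambda>x. complex_of_real (f x)) differentiable (at x)"
      using ex[of "is"] diff by auto
  qed
qed

lemma exists_cutoff:
  obtains \<eta> :: "real ^ 'n::finite \<Rightarrow> complex" where
    "\<eta> \<in> test_functions UNIV" "\<And>x. norm x \<le> 1 \<Longrightarrow> \<eta> x = 1" "supp \<eta> \<subseteq> cball 0 2"
proof -
  \<comment> \<open>The inner \<open>flat_exp\<close> vanishes for \<open>norm x \<le> 1\<close> and
    reaches \<open>exp (-1)\<close> once the squared norm is at least \<open>2\<close>. The argument
    of the outer one is therefore \<open>exp (-1)\<close> on the unit ball and nonpositive for
    \<open>norm x > 2\<close>; the factor \<open>exp (exp 1)\<close> normalises the value on the
    ball to \<open>1\<close>.\<close>
  define g :: "real ^ 'n \<Rightarrow> real" where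
    "g x = exp (exp 1) * flat_exp 0 (exp (-1) + (-1) * flat_exp 0 ((\<Sum>i\<in>UNIV. x $ i * x $ i) + (-1)))" for x
  have norm_sq: "(\<Sum>i\<in>UNIV. x $ i * x $ i) = (norm x)\<^sup>2" for x :: "real ^ 'n"
    by (simp add: power2_norm_eq_inner inner_vec_def)
  have "g \<in> elementary"
    unfolding g_def[abs_def] by (intro elementary.intros elementary_sum) auto
  then have smooth: "smooth_on UNIV (\<lambda>x. complex_of_real (g x))"
    by (rule elementary_smooth_on)
  have one: "g x = 1" if "norm x \<le> 1" for x
    using power_le_one[OF norm_ge_zero that, of 2]
    by (simp add: g_def norm_sq flat_exp_def exp_minus flip: exp_add)
  have zero: "g x = 0" if "norm x > 2" for x
  proof -
    have "(norm x)\<^sup>2 \<ge> 2\<^sup>2"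
      using that by (intro power_mono) auto
    then have "inverse ((norm x)\<^sup>2 - 1) \<le> inverse 1"
      by (intro le_imp_inverse_le) auto
    then have "exp (-1) \<le> exp (- inverse ((norm x)\<^sup>2 - 1))"
      by simp
    then show ?thesis
      using \<open>(norm x)\<^sup>2 \<ge> 2\<^sup>2\<close> by (simp add: g_def norm_sq flat_exp_def)
  qed
  have supp: "supp (\<lambda>x. complex_of_real (g x)) \<subseteq> cball 0 2"
    unfolding supp_def using zero by (intro closure_minimal) (auto intro: ccontr)
  have "(\<lambda>x. complex_of_real (g x)) \<in> test_functions UNIV"
    using smooth compact_supp_subset[OF compact_cball supp] by (auto simp: test_functions_def)
  with one supp show thesis
    using that[of "\<lambda>x. complex_of_real (g x)"] by simp
qed

subsection \<open>Leibniz rule\<close>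

text \<open>Each entry assigns every derivative of the list to one of two factors. Repetitions among
  the entries stand for the binomial coefficients of the Leibniz rule.\<close>

fun leibniz_splits :: "'a list \<Rightarrow> ('a list \<times> 'a list) list" where
  "leibniz_splits [] = [([], [])]"
| "leibniz_splits (i # is) = map (\<lambda>(a, b). (i # a, b)) (leibniz_splits is) @ map (\<lambda>(a, b). (a, i # b)) (leibniz_splits is)"

lemma length_leibniz_splits: "length (leibniz_splits is) = 2 ^ length is"
  by (induction "is") auto

lemma leibniz_splits_length_eq: "(a, b) \<in> set (leibniz_splits is) \<Longrightarrow> length a + length b = length is"
  by (induction "is" arbitrary: a b) auto

lemma has_derivative_sum_list_products:
  fixes f g :: "real ^ 'n::finite \<Rightarrow> complex"
  assumes "smooth_on UNIV f" "smooth_on UNIV g"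
  shows "((\<lambda>x. \<Sum>(a, b)\<leftarrow>ps. iter_partial a f x * iter_partial b g x) has_derivative
    (\<lambda>h. \<Sum>(a, b)\<leftarrow>ps. iter_partial a f x * frechet_derivative (iter_partial b g) (at x) h
       + frechet_derivative (iter_partial a f) (at x) h * iter_partial b g x)) (at x)"
proof (induction ps)
  case (Cons p ps)
  obtain a b where p: "p = (a, b)" by force
  show ?case
    using has_derivative_add[OF has_derivative_mult[OF smooth_onD_has_derivative[OF assms(1), of a]
        smooth_onD_has_derivative[OF assms(2), of b]] Cons.IH] by (simp add: p)
qed simp

lemma iter_partial_mult:
  assumes "smooth_on UNIV f" "smooth_on UNIV g"
  shows "iter_partial is (\<lambda>x. f x * g x) =
    (\<lambda>x. \<Sum>(a, b)\<leftarrow>leibniz_splits is. iter_partial a f x * iter_partial b g x)"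
proof (induction "is")
  case (Cons i "is")
  have "frechet_derivative (iter_partial is (\<lambda>x. f x * g x)) (at x) (axis i 1) =
      (\<Sum>(a, b)\<leftarrow>leibniz_splits is. iter_partial a f x * iter_partial (i # b) g x
         + iter_partial (i # a) f x * iter_partial b g x)" for x
    unfolding Cons.IH frechet_derivative_eqI[OF has_derivative_sum_list_products[OF assms]] by simp
  then show ?case
    by (auto simp: comp_def case_prod_unfold sum_list_addf)
qed simp

lemma smooth_on_mult:
  assumes "smooth_on UNIV f" "smooth_on UNIV g"
  shows "smooth_on UNIV (\<lambda>x. f x * g x)"
  unfolding smooth_on_def iter_partial_mult[OF assms] differentiable_def
  using has_derivative_sum_list_products[OF assms] by blast

lemma test_functions_mult:
  assumes "smooth_on UNIV f" "g \<in> test_functions UNIV"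
  shows "(\<lambda>x. f x * g x) \<in> test_functions UNIV"
proof -
  have "supp (\<lambda>x. f x * g x) \<subseteq> supp g"
    unfolding supp_def by (rule closure_mono) auto
  then show ?thesis
    using assms compact_supp_subset by (auto simp: test_functions_def smooth_on_mult)
qed

subsection \<open>Distributions supported at the origin\<close>

text \<open>By flatness, a derivative of \<open>f\<close> of order \<open>k \<le> N\<close> is
  O(|x|^(N+1-k)), and the cutoff restricts attention to \<open>norm x \<le> 2 * \<epsilon>\<close>.
  Each derivative falling on the cutoff costs one factor \<open>1 / \<epsilon>\<close>; since at
  most \<open>N\<close> derivatives are taken in all, at least one power of
  \<open>\<epsilon>\<close> survives.\<close>

lemma Ck_seminorm_cutoff_flat:
  fixes f :: "real ^ 'n::finite \<Rightarrow> complex"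
  assumes f: "f \<in> test_functions UNIV" and flat: "\<And>is. length is \<le> N \<Longrightarrow> iter_partial is f 0 = 0"
    and \<eta>: "\<eta> \<in> test_functions UNIV" "supp \<eta> \<subseteq> cball 0 2"
  obtains B where "\<And>\<epsilon>. 0 < \<epsilon> \<Longrightarrow> \<epsilon> \<le> 1 \<Longrightarrow> Ck_seminorm N (\<lambda>x. \<eta> (inverse \<epsilon> *\<^sub>R x) * f x) \<le> B * \<epsilon>"
proof -
  define n where "n = real CARD('n)"
  have n: "n \<ge> 1" unfolding n_def using zero_less_card_finite[where 'a = 'n] by linarith
  define A where "A = Ck_seminorm N \<eta>"
  define C where "C = Ck_seminorm (N + 1) f"
  have A: "0 \<le> A" and C: "0 \<le> C"
    using Ck_seminorm_nonneg f \<eta> by (auto simp: A_def C_def)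
  have sm: "smooth_on UNIV f" "smooth_on UNIV \<eta>"
    using f \<eta> by (auto simp: test_functions_def)
  have f_bound: "norm (iter_partial b f x) \<le> n ^ (N + 1 - length b) * C * norm x ^ (N + 1 - length b)"
    if "length b \<le> N" for b x
  proof -
    have "iter_partial a (iter_partial b f) 0 = 0" if "length a < N + 1 - length b" for a
      using flat[of "a @ b"] that by (auto simp: iter_partial_append)
    then have "(\<Sum>k<N + 1 - length b. taylor_part k (iter_partial b f) x) = 0"
      by (auto simp: taylor_part_def intro!: sum.neutral)
    moreover have "norm (iter_partial a (iter_partial b f) x) \<le> C" if "length a = N + 1 - length b" for a x
      using iter_partial_le_Ck_seminorm[OF f, of "a @ b" "N + 1" x] that \<open>length b \<le> N\<close>
      by (auto simp: iter_partial_append C_def)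
    ultimately show ?thesis
      using taylor_remainder_bound[OF smooth_on_iter_partial[OF sm(1)], of "N + 1 - length b" b C x]
      by (simp add: n_def)
  qed
  define M where "M = A * (n ^ (N + 1) * C * 2 ^ (N + 1))"
  have M: "0 \<le> M" using A C n by (simp add: M_def)
  have term_bound: "norm (iter_partial a (\<lambda>x. \<eta> (inverse \<epsilon> *\<^sub>R x)) x * iter_partial b f x) \<le> M * \<epsilon>"
    if \<epsilon>: "0 < \<epsilon>" "\<epsilon> \<le> 1" and ab: "length a + length b \<le> N" for \<epsilon> a b x
  proof (cases "norm x \<le> 2 * \<epsilon>")
    case False
    then have "inverse \<epsilon> *\<^sub>R x \<notin> cball 0 2"
      using \<epsilon> by (auto simp: field_simps)
    then have "iter_partial a \<eta> (inverse \<epsilon> *\<^sub>R x) = 0"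
      using \<eta> by (intro iter_partial_outside_supp) auto
    then show ?thesis
      using M \<epsilon> by (simp add: iter_partial_dilate[OF sm(2)])
  next
    case True
    define j where "j = N + 1 - length b"
    \<comment> \<open>The truncated subtraction is exact because
      \<open>length a + length b \<le> N\<close>; the \<open>Suc\<close> is the surviving power of
      \<open>\<epsilon>\<close>.\<close>
    have j: "j = length a + Suc (j - length a - 1)" "j \<le> N + 1"
      using ab by (auto simp: j_def)
    have "norm (iter_partial a (\<lambda>x. \<eta> (inverse \<epsilon> *\<^sub>R x)) x) \<le> inverse \<epsilon> ^ length a * A"
      using iter_partial_le_Ck_seminorm[OF \<eta>(1), of a N "inverse \<epsilon> *\<^sub>R x"] ab \<epsilon>
      by (auto simp: iter_partial_dilate[OF sm(2)] norm_mult norm_power norm_inverse A_def)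
    moreover have "norm (iter_partial b f x) \<le> n ^ (N + 1) * C * 2 ^ (N + 1) * \<epsilon> ^ j"
    proof -
      have "norm (iter_partial b f x) \<le> n ^ j * C * norm x ^ j"
        using f_bound[of b x] ab by (simp add: j_def)
      also have "\<dots> \<le> n ^ (N + 1) * C * (2 * \<epsilon>) ^ j"
        using n C True j by (intro mult_mono power_mono power_increasing) auto
      also have "\<dots> = n ^ (N + 1) * C * 2 ^ j * \<epsilon> ^ j"
        by (simp add: power_mult_distrib)
      also have "\<dots> \<le> n ^ (N + 1) * C * 2 ^ (N + 1) * \<epsilon> ^ j"
        using n C \<epsilon> j by (intro mult_right_mono mult_left_mono power_increasing) auto
      finally show ?thesis .
    qed
    ultimately have "norm (iter_partial a (\<lambda>x. \<eta> (inverse \<epsilon> *\<^sub>R x)) x * iter_partial b f x)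
        \<le> (inverse \<epsilon> ^ length a * A) * (n ^ (N + 1) * C * 2 ^ (N + 1) * \<epsilon> ^ j)"
      using A \<epsilon> unfolding norm_mult by (intro mult_mono) auto
    also have "\<dots> = M * (inverse \<epsilon> ^ length a * \<epsilon> ^ j)"
      by (simp add: M_def)
    also have "inverse \<epsilon> ^ length a * \<epsilon> ^ j = \<epsilon> ^ Suc (j - length a - 1)"
      using \<epsilon> by (subst j(1)) (simp only: power_add power_inverse, simp)
    also have "M * \<epsilon> ^ Suc (j - length a - 1) \<le> M * \<epsilon>"
      using M \<epsilon> by (intro mult_left_mono) (auto simp: mult_left_le power_le_one)
    finally show ?thesis .
  qed
  have bound: "norm (iter_partial is (\<lambda>x. \<eta> (inverse \<epsilon> *\<^sub>R x) * f x) x) \<le> 2 ^ N * (M * \<epsilon>)"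
    if \<epsilon>: "0 < \<epsilon>" "\<epsilon> \<le> 1" and l: "length is \<le> N" for \<epsilon> "is" x
  proof -
    let ?t = "\<lambda>(a, b). iter_partial a (\<lambda>x. \<eta> (inverse \<epsilon> *\<^sub>R x)) x * iter_partial b f x"
    have *: "norm (sum_list (map ?t ps)) \<le> length ps * (M * \<epsilon>)"
      if "\<And>a b. (a, b) \<in> set ps \<Longrightarrow> length a + length b \<le> N" for ps
      using that
    proof (induction ps)
      case (Cons p ps)
      have "norm (?t p) \<le> M * \<epsilon>"
        using Cons.prems[of "fst p" "snd p"] term_bound[OF \<epsilon>, of "fst p" "snd p" x]
        by (simp add: case_prod_unfold)
      moreover have "norm (sum_list (map ?t ps)) \<le> length ps * (M * \<epsilon>)"
        using Cons by auto
      ultimately show ?case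
        using norm_triangle_ineq[of "?t p" "sum_list (map ?t ps)"] by (simp add: distrib_right)
    qed simp
    have "norm (iter_partial is (\<lambda>x. \<eta> (inverse \<epsilon> *\<^sub>R x) * f x) x) \<le> length (leibniz_splits is) * (M * \<epsilon>)"
      unfolding iter_partial_mult[OF smooth_on_dilate[OF sm(2)] sm(1)]
      using leibniz_splits_length_eq l by (intro *) fastforce
    also have "\<dots> \<le> 2 ^ N * (M * \<epsilon>)"
      using M \<epsilon> l by (intro mult_right_mono) (auto simp: length_leibniz_splits)
    finally show ?thesis .
  qed
  show thesis
  proof (rule that)
    fix \<epsilon> :: real assume \<epsilon>: "0 < \<epsilon>" "\<epsilon> \<le> 1"
    have "Ck_seminorm N (\<lambda>x. \<eta> (inverse \<epsilon> *\<^sub>R x) * f x) \<le> of_nat (card {is :: 'n list. length is \<le> N}) * (2 ^ N * (M * \<epsilon>))"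
      unfolding Ck_seminorm_def
      by (rule sum_bounded_above) (use bound[OF \<epsilon>] in \<open>auto intro: cSUP_least\<close>)
    then show "Ck_seminorm N (\<lambda>x. \<eta> (inverse \<epsilon> *\<^sub>R x) * f x)
        \<le> (of_nat (card {is :: 'n list. length is \<le> N}) * (2 ^ N * M)) * \<epsilon>"
      by (simp add: mult_ac)
  qed
qed

text \<open>Split \<open>f\<close> by a cutoff at scale \<open>\<epsilon>\<close>. The outer piece
  vanishes near \<open>0\<close> and is annihilated, while the inner piece has seminorm of order
  \<open>\<epsilon>\<close>; then \<open>\<epsilon>\<close> tends to \<open>0\<close>.\<close>

lemma vanishes_on_flat:
  fixes f :: "real ^ 'n::finite \<Rightarrow> complex"
  assumes add: "\<And>f g. f \<in> test_functions UNIV \<Longrightarrow> g \<in> test_functions UNIV \<Longrightarrow> v (\<lambda>x. f x + g x) = v f + v g"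
    and bound: "\<And>f. f \<in> test_functions UNIV \<Longrightarrow> supp f \<subseteq> cball 0 2 \<Longrightarrow> norm (v f) \<le> C * Ck_seminorm N f"
    and zero: "\<And>f. f \<in> test_functions (- {0}) \<Longrightarrow> v f = 0"
    and f: "f \<in> test_functions UNIV" and flat: "\<And>is. length is \<le> N \<Longrightarrow> iter_partial is f 0 = 0"
  shows "v f = (0 :: complex)"
proof -
  obtain \<eta> :: "real ^ 'n::finite \<Rightarrow> complex" where
    \<eta>: "\<eta> \<in> test_functions UNIV" "\<And>x. norm x \<le> 1 \<Longrightarrow> \<eta> x = 1" "supp \<eta> \<subseteq> cball 0 2"
    using exists_cutoff by blast
  obtain B where
    B: "\<And>\<epsilon>. 0 < \<epsilon> \<Longrightarrow> \<epsilon> \<le> 1 \<Longrightarrow> Ck_seminorm N (\<lambda>x. \<eta> (inverse \<epsilon> *\<^sub>R x) * f x) \<le> B * \<epsilon>"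
    using Ck_seminorm_cutoff_flat[OF f flat \<eta>(1,3)] by blast
  have est: "norm (v f) \<le> \<bar>C\<bar> * \<bar>B\<bar> * \<epsilon>" if \<epsilon>: "0 < \<epsilon>" "\<epsilon> \<le> 1" for \<epsilon>
  proof -
    define g where "g x = \<eta> (inverse \<epsilon> *\<^sub>R x) * f x" for x
    have g: "g \<in> test_functions UNIV"
      unfolding g_def[abs_def]
      using \<eta>(1) f by (intro test_functions_mult smooth_on_dilate) (auto simp: test_functions_def)
    \<comment> \<open>All inner pieces with \<open>\<epsilon> \<le> 1\<close> live in one fixed
      ball, so a single continuity estimate with constants \<open>C\<close> and \<open>N\<close>
      covers them.\<close>
    have "norm x \<le> 2" if "g x \<noteq> 0" for x
    proof -
      have "inverse \<epsilon> *\<^sub>R x \<in> supp \<eta>"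
        using that iter_partial_outside_supp[of "inverse \<epsilon> *\<^sub>R x" \<eta> "[]"] by (auto simp: g_def)
      then have "inverse \<epsilon> *\<^sub>R x \<in> cball 0 2"
        using \<eta>(3) by blast
      then have "norm x \<le> 2 * \<epsilon>" using \<epsilon> by (simp add: field_simps)
      then show ?thesis using \<epsilon> by linarith
    qed
    then have g_supp: "supp g \<subseteq> cball 0 2"
      unfolding supp_def by (intro closure_minimal) auto
    define h where "h x = f x + (-1) * g x" for x
    have h: "h \<in> test_functions UNIV"
      unfolding h_def[abs_def] by (intro test_functions_add test_functions_cmult f g)
    have "h x = 0" if "norm x < \<epsilon>" for x
      using that \<eta>(2)[of "inverse \<epsilon> *\<^sub>R x"] \<epsilon> by (simp add: h_def g_def field_simps)
    then have "supp h \<subseteq> {x. \<epsilon> \<le> norm x}"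
      unfolding supp_def
      by (intro closure_minimal closed_Collect_le continuous_intros) (auto simp: not_less[symmetric])
    then have "v h = 0"
      using h \<epsilon> by (intro zero) (auto simp: test_functions_def)
    then have "v f = v g"
      using add[OF g h] by (simp add: h_def)
    then have "norm (v f) \<le> C * Ck_seminorm N g"
      using bound[OF g g_supp] by simp
    also have "\<dots> \<le> \<bar>C\<bar> * (\<bar>B\<bar> * \<epsilon>)"
    proof (rule mult_mono)
      have "Ck_seminorm N g \<le> B * \<epsilon>"
        using B[OF \<epsilon>] by (simp add: g_def[abs_def])
      also have "\<dots> \<le> \<bar>B\<bar> * \<epsilon>"
        using \<epsilon> by (intro mult_right_mono) auto
      finally show "Ck_seminorm N g \<le> \<bar>B\<bar> * \<epsilon>" .
    qed (use Ck_seminorm_nonneg[OF g] in auto)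
    finally show ?thesis by (simp add: mult_ac)
  qed
  have "((\<lambda>\<epsilon>. \<bar>C\<bar> * \<bar>B\<bar> * \<epsilon>) \<longlongrightarrow> \<bar>C\<bar> * \<bar>B\<bar> * 0) (at_right 0)"
    by (intro tendsto_intros)
  moreover have "\<forall>\<^sub>F \<epsilon> in at_right 0. norm (v f) \<le> \<bar>C\<bar> * \<bar>B\<bar> * \<epsilon>"
    unfolding eventually_at_right[OF zero_less_one] by (rule exI[of _ 1]) (use est in auto)
  ultimately have "norm (v f) \<le> \<bar>C\<bar> * \<bar>B\<bar> * 0"
    by (rule tendsto_lowerbound) simp
  then show ?thesis by simp
qed

text \<open>In \<open>hom\<close> the dilation acts on the test function, so the exponent is
  \<open>- d - n\<close>: the degree changes sign and the Jacobian contributes \<open>- n\<close>.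
  At \<open>t = -1\<close> the Jacobian is \<open>1\<close>, so \<open>par\<close> keeps the factor
  \<open>(-1) powi d\<close>.\<close>

lemma homogeneous_regular_parity_supported_at_0:
  fixes v :: "(real ^ 'n::finite \<Rightarrow> complex) \<Rightarrow> complex"
  assumes "odd CARD('n)"
    and add: "\<And>f g. f \<in> test_functions UNIV \<Longrightarrow> g \<in> test_functions UNIV \<Longrightarrow> v (\<lambda>x. f x + g x) = v f + v g"
    and cmult: "\<And>f c. f \<in> test_functions UNIV \<Longrightarrow> v (\<lambda>x. c * f x) = c * v f"
    and bound: "\<And>f. f \<in> test_functions UNIV \<Longrightarrow> supp f \<subseteq> cball 0 2 \<Longrightarrow> norm (v f) \<le> C * Ck_seminorm N f"
    and zero: "\<And>f. f \<in> test_functions (- {0}) \<Longrightarrow> v f = 0"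
    and hom: "\<And>f t. t > 0 \<Longrightarrow> f \<in> test_functions UNIV \<Longrightarrow>
      v (\<lambda>x. f (t *\<^sub>R x)) = of_real (t powi (- d - int CARD('n))) * v f"
    and par: "\<And>f. f \<in> test_functions UNIV \<Longrightarrow> v (\<lambda>x. f ((-1) *\<^sub>R x)) = (-1) powi d * v f"
    and f: "f \<in> test_functions UNIV"
  shows "v f = 0"
proof -
  \<comment> \<open>The induction runs downwards, from \<open>Suc N\<close>, where
    \<open>vanishes_on_flat\<close> applies, to \<open>0\<close>, where the flatness condition is
    void.\<close>
  have "\<forall>f\<in>test_functions UNIV. (\<forall>is. length is < 0 \<longrightarrow> iter_partial is f 0 = 0) \<longrightarrow> v f = 0"
  proof (rule inc_induct[of 0 "Suc N"])
    show "\<forall>f\<in>test_functions UNIV. (\<forall>is. length is < Suc N \<longrightarrow> iter_partial is f 0 = 0) \<longrightarrow> v f = 0"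
    proof (intro ballI impI)
      fix f :: "real ^ 'n \<Rightarrow> complex"
      assume "f \<in> test_functions UNIV" "\<forall>is. length is < Suc N \<longrightarrow> iter_partial is f 0 = 0"
      then show "v f = 0"
        by (intro vanishes_on_flat[of v C N, OF add bound zero]) auto
    qed
  next
    fix j
    assume IH: "\<forall>f\<in>test_functions UNIV. (\<forall>is. length is < Suc j \<longrightarrow> iter_partial is f 0 = 0) \<longrightarrow> v f = 0"
    \<comment> \<open>\<open>f(s x) - s\<^sup>j f(x)\<close> kills the derivatives of order \<open>j\<close> at \<open>0\<close>, while \<open>v\<close> of it is
      \<open>(\<sigma> - s\<^sup>j) v(f)\<close>. The choice \<open>s = 2\<close> fails only for \<open>j = - d - n\<close>, where parity allows \<open>s = -1\<close>.\<close>
    obtain s :: real and \<sigma> :: complex where s: "s \<noteq> 0" "\<sigma> \<noteq> of_real s ^ j"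
      "\<And>f. f \<in> test_functions UNIV \<Longrightarrow> v (\<lambda>x. f (s *\<^sub>R x)) = \<sigma> * v f"
    proof (cases "- d - int CARD('n) = int j")
      case False
      have "(2::real) powi (- d - int CARD('n)) \<noteq> 2 powi (int j)"
        using False power_int_strict_increasing[of _ _ "2::real"] by (metis less_irrefl linorder_neqE one_less_numeral_iff semiring_norm(76))
      then have "complex_of_real (2 powi (- d - int CARD('n))) \<noteq> of_real 2 ^ j"
        by (metis of_real_eq_iff of_real_power power_int_of_nat)
      then show ?thesis using hom[of 2] by (intro that[of 2]) auto
    next
      case True
      then have "d = - (int CARD('n) + int j)" by simp
      then have "even d \<longleftrightarrow> odd j"
        using \<open>odd CARD('n)\<close> by simp
      then have "(-1) powi d \<noteq> (complex_of_real (-1)) ^ j"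
        by (cases "even d") (auto simp: power_int_minus_left)
      then show ?thesis using par by (intro that[of "-1"]) auto
    qed
    show "\<forall>f\<in>test_functions UNIV. (\<forall>is. length is < j \<longrightarrow> iter_partial is f 0 = 0) \<longrightarrow> v f = 0"
    proof (intro ballI impI)
      fix f :: "real ^ 'n \<Rightarrow> complex"
      assume f: "f \<in> test_functions UNIV" and flat: "\<forall>is. length is < j \<longrightarrow> iter_partial is f 0 = 0"
      have sm: "smooth_on UNIV f" using f by (simp add: test_functions_def)
      define g where "g x = f (s *\<^sub>R x) + (- (of_real s ^ j)) * f x" for x
      have fs: "(\<lambda>x. f (s *\<^sub>R x)) \<in> test_functions UNIV" "(\<lambda>x. (- (of_real s ^ j)) * f x) \<in> test_functions UNIV"
        by (rule test_functions_dilate[OF f s(1)]) (rule test_functions_cmult[OF f])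
      have "iter_partial is g 0 = (of_real s ^ length is - of_real s ^ j) * iter_partial is f 0" for "is"
        unfolding g_def[abs_def] iter_partial_add[OF smooth_on_dilate[OF sm] smooth_on_cmult[OF sm]]
          iter_partial_dilate[OF sm] iter_partial_cmult[OF sm]
        by (simp add: algebra_simps)
      then have "\<forall>is. length is < Suc j \<longrightarrow> iter_partial is g 0 = 0"
        using flat by (auto simp: less_Suc_eq)
      then have "v g = 0"
        using IH test_functions_add[OF fs] by (simp add: g_def[abs_def])
      moreover have "v g = (\<sigma> - of_real s ^ j) * v f"
        unfolding g_def[abs_def] add[OF fs] s(3)[OF f] cmult[OF f] by (simp add: algebra_simps)
      ultimately show "v f = 0" using s(2) by simp
    qed
  qed simp
  then show ?thesis using f by simp
qed

subsection \<open>An integrable majorant\<close>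

lemma dyadic_interval:
  assumes "(1::real) \<le> y"
  obtains j where "2 ^ j \<le> y" "y < 2 ^ Suc j"
proof -
  obtain m where "y < 2 ^ m"
    using real_arch_pow[of 2 y] by auto
  then obtain j where "\<forall>i\<le>j. \<not> y < 2 ^ i" "y < 2 ^ Suc j"
    using ex_least_nat_less[of "\<lambda>m. y < 2 ^ m" m] assms by auto
  then show thesis using that[of j] by (auto simp: not_less)
qed

text \<open>The volume of a ball is a constant times the radius to the power of the dimension, so
  the last hypothesis bounds the integrated series by a geometric one.\<close>

lemma nn_integral_sum_cballs_finite:
  fixes c r :: "nat \<Rightarrow> real" and D :: real
  assumes "\<And>j. 0 \<le> c j" "\<And>j. 0 \<le> r j" "\<And>j. c j * r j ^ DIM('a) \<le> D * (1 / 2) ^ j"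
  shows "(\<integral>\<^sup>+ x. (\<Sum>j. ennreal (c j) * indicator (cball (0::'a::euclidean_space) (r j)) x) \<partial>lborel) < \<infinity>"
proof -
  have [measurable]: "cball (0 :: 'a) \<rho> \<in> sets borel" for \<rho> by simp
  have D: "0 \<le> D"
    using order_trans[OF mult_nonneg_nonneg[OF assms(1)[of 0] zero_le_power[OF assms(2)[of 0]]] assms(3)[of 0]]
    by simp
  have "(\<integral>\<^sup>+ x. (\<Sum>j. ennreal (c j) * indicator (cball (0::'a) (r j)) x) \<partial>lborel)
      = (\<Sum>j. ennreal (c j) * emeasure lborel (cball (0::'a) (r j)))"
    by (subst nn_integral_suminf) (measurable, simp add: nn_integral_cmult_indicator)
  also have "\<dots> \<le> (\<Sum>j. ennreal (unit_ball_vol DIM('a) * D * (1 / 2) ^ j))"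
  proof (intro suminf_le summableI)
    fix j
    have "ennreal (c j) * emeasure lborel (cball (0::'a) (r j)) =
        ennreal (unit_ball_vol DIM('a) * (c j * r j ^ DIM('a)))"
      using assms(1,2) by (simp add: emeasure_cball ennreal_mult'[symmetric] mult_ac)
    also have "\<dots> \<le> ennreal (unit_ball_vol DIM('a) * (D * (1 / 2) ^ j))"
      using assms(3) by (intro ennreal_leI mult_left_mono) auto
    finally show "ennreal (c j) * emeasure lborel (cball (0::'a) (r j))
        \<le> ennreal (unit_ball_vol DIM('a) * D * (1 / 2) ^ j)" by (simp add: mult_ac)
  qed
  also have "\<dots> = ennreal (\<Sum>j. unit_ball_vol DIM('a) * D * (1 / 2) ^ j)"
    using D by (intro suminf_ennreal2 summable_mult summable_geometric) auto
  finally show ?thesis by (rule order_le_less_trans) simp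
qed

text \<open>The two exponents lie one above and one below the critical value \<open>- n\<close>,
  which gives integrability at the origin and at infinity respectively.\<close>

definition majorant :: "real ^ 'n::finite \<Rightarrow> real" where
  "majorant x = (if norm x \<le> 1 then norm x powi (1 - int CARD('n)) else norm x powi (- int CARD('n) - 1))"

lemma majorant_nonneg: "0 \<le> majorant x"
  by (simp add: majorant_def)

text \<open>On a dyadic shell the majorant is at most the coefficient belonging to that shell, and
  the shell is enlarged to a ball of explicit volume. The first sum treats the unit ball, the second
  its complement.\<close>

lemma majorant_le_sum_cballs:
  fixes x :: "real ^ 'n::finite"
  assumes "x \<noteq> 0"
  shows "ennreal (majorant x) \<le>
    (\<Sum>j. ennreal (2 ^ (Suc j * (CARD('n) - 1))) * indicator (cball (0 :: real ^ 'n) (1 / 2 ^ j)) x) +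
    (\<Sum>j. ennreal (1 / 2 ^ (j * (CARD('n) + 1))) * indicator (cball (0 :: real ^ 'n) (2 ^ Suc j)) x)"
    (is "_ \<le> (\<Sum>j. ?a j) + (\<Sum>j. ?b j)")
proof -
  have term_le: "f j \<le> suminf f" for f :: "nat \<Rightarrow> ennreal" and j
    using sum_le_suminf[of f "{j}"] by simp
  have pos: "norm x > 0" using assms by simp
  show ?thesis
  proof (cases "norm x \<le> 1")
    case True
    obtain j where j: "2 ^ j \<le> inverse (norm x)" "inverse (norm x) < 2 ^ Suc j"
      using dyadic_interval[of "inverse (norm x)"] True pos by (auto simp: one_le_inverse_iff)
    have "majorant x = inverse (norm x) ^ (CARD('n) - 1)"
    proof -
      have "1 - int CARD('n) = - int (CARD('n) - 1)"
        using zero_less_card_finite[where 'a = 'n] by linarith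
      then show ?thesis
        using True unfolding majorant_def power_inverse by (simp only: power_int_minus power_int_of_nat if_True)
    qed
    also have "\<dots> \<le> (2 ^ Suc j) ^ (CARD('n) - 1)"
      using j by (intro power_mono) auto
    also have "\<dots> = 2 ^ (Suc j * (CARD('n) - 1))"
      by (rule power_mult[symmetric])
    finally have "ennreal (majorant x) \<le> ennreal (2 ^ (Suc j * (CARD('n) - 1)))"
      by (rule ennreal_leI)
    moreover have "x \<in> cball 0 (1 / 2 ^ j)"
      using j(1) pos by (simp add: field_simps)
    ultimately have "ennreal (majorant x) \<le> ?a j" by simp
    also have "\<dots> \<le> (\<Sum>j. ?a j)" by (rule term_le)
    finally show ?thesis by (rule order_trans) simp
  next
    case False
    obtain j where j: "2 ^ j \<le> norm x" "norm x < 2 ^ Suc j"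
      using dyadic_interval[of "norm x"] False by auto
    have "majorant x = 1 / norm x ^ (CARD('n) + 1)"
    proof -
      have "- int CARD('n) - 1 = - int (CARD('n) + 1)" by simp
      then show ?thesis
        using False unfolding majorant_def by (simp only: power_int_minus power_int_of_nat if_False inverse_eq_divide)
    qed
    also have "\<dots> \<le> 1 / (2 ^ j) ^ (CARD('n) + 1)"
      using j pos by (intro divide_left_mono power_mono) auto
    also have "\<dots> = 1 / 2 ^ (j * (CARD('n) + 1))"
      by (simp only: power_mult)
    finally have "ennreal (majorant x) \<le> ennreal (1 / 2 ^ (j * (CARD('n) + 1)))"
      by (rule ennreal_leI)
    moreover have "x \<in> cball 0 (2 ^ Suc j)"
      using j(2) by simp
    ultimately have "ennreal (majorant x) \<le> ?b j" by simp
    also have "\<dots> \<le> (\<Sum>j. ?b j)" by (rule term_le)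
    finally show ?thesis by (rule order_trans) simp
  qed
qed

lemma borel_measurable_majorant [measurable]: "majorant \<in> borel_measurable borel"
proof -
  have "(\<lambda>x. norm (x :: real ^ 'n) powi k) \<in> borel_measurable borel" for k
    by (rule borel_measurable_continuous_countable_exceptions[of "{0}"]) (auto intro!: continuous_intros)
  then show ?thesis unfolding majorant_def[abs_def] by measurable
qed

lemma integrable_majorant: "integrable lborel (majorant :: real ^ 'n::finite \<Rightarrow> real)"
proof (rule integrableI_bounded)
  have n: "CARD('n) > 0" by simp
  have [measurable]: "cball (0 :: real ^ 'n) r \<in> sets borel" for r by simp
  let ?A = "\<lambda>x :: real ^ 'n. \<Sum>j. ennreal (2 ^ (Suc j * (CARD('n) - 1))) * indicator (cball (0 :: real ^ 'n) (1 / 2 ^ j)) x"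
  let ?B = "\<lambda>x :: real ^ 'n. \<Sum>j. ennreal (1 / 2 ^ (j * (CARD('n) + 1))) * indicator (cball (0 :: real ^ 'n) (2 ^ Suc j)) x"
  have "(\<integral>\<^sup>+ x. ennreal (norm (majorant (x :: real ^ 'n))) \<partial>lborel) \<le> (\<integral>\<^sup>+ x. ?A x + ?B x \<partial>lborel)"
  proof (rule nn_integral_mono_AE)
    show "AE x in lborel. ennreal (norm (majorant x)) \<le> ?A x + ?B x"
      using AE_lborel_singleton[of "0 :: real ^ 'n"]
    proof eventually_elim
      case (elim x)
      then show ?case using majorant_le_sum_cballs[of x] majorant_nonneg[of x] by simp
    qed
  qed
  also have "\<dots> = (\<integral>\<^sup>+ x. ?A x \<partial>lborel) + (\<integral>\<^sup>+ x. ?B x \<partial>lborel)"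
    by (rule nn_integral_add) measurable
  also have "\<dots> < \<infinity>"
  proof -
    \<comment> \<open>In both families coefficient times radius to the power \<open>n\<close> decays
      like \<open>2 ^ (- j)\<close>; the common constant \<open>2 ^ n\<close> fits the two of
      them.\<close>
    have "(2::real) ^ (Suc j * (CARD('n) - 1)) * (1 / 2 ^ j) ^ CARD('n) \<le> 2 ^ CARD('n) * (1 / 2) ^ j" for j
    proof -
      obtain m where m: "CARD('n) = Suc m" using n by (cases "CARD('n)") auto
      have "(2::real) ^ (Suc j * m) * (1 / 2 ^ j) ^ Suc m = 2 ^ m * (1 / 2) ^ j"
        by (simp add: power_add power_mult power_divide)
      also have "\<dots> \<le> 2 ^ Suc m * (1 / 2) ^ j"
        by (intro mult_right_mono power_increasing) auto
      finally show ?thesis unfolding m by simp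
    qed
    moreover have "1 / (2::real) ^ (j * (CARD('n) + 1)) * (2 ^ Suc j) ^ CARD('n) \<le> 2 ^ CARD('n) * (1 / 2) ^ j" for j
    proof -
      have "(2::real) ^ (j * (CARD('n) + 1)) = (2 ^ j) ^ CARD('n) * 2 ^ j"
        by (simp add: power_add power_mult)
      then show ?thesis by (simp add: power_mult_distrib power_divide)
    qed
    ultimately have "(\<integral>\<^sup>+ x. ?A x \<partial>lborel) < \<infinity>" "(\<integral>\<^sup>+ x. ?B x \<partial>lborel) < \<infinity>"
      by (intro nn_integral_sum_cballs_finite[where D = "2 ^ CARD('n)"]; simp)+
    then show ?thesis by simp
  qed
  finally show "(\<integral>\<^sup>+ x. ennreal (norm (majorant (x :: real ^ 'n))) \<partial>lborel) < \<infinity>" .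
qed simp

section \<open>Change of variables and auxiliary facts\<close>

lemma integral_lborel_dilate:
  fixes f :: "real ^ 'n::finite \<Rightarrow> complex"
  assumes [measurable]: "f \<in> borel_measurable borel" and "s \<noteq> 0"
  shows "(\<integral>x. f (s *\<^sub>R x) \<partial>lborel) = (\<integral>x. f x \<partial>lborel) / of_real (\<bar>s\<bar> ^ CARD('n))"
proof -
  have "(\<integral>x. f x \<partial>lborel) =
      (\<integral>x. f x \<partial>density (distr lborel borel (\<lambda>x. 0 + s *\<^sub>R x)) (\<lambda>_. ennreal (\<bar>s\<bar> ^ DIM(real ^ 'n))))"
    using lborel_affine[OF \<open>s \<noteq> 0\<close>, of "0 :: real ^ 'n"] by (simp add: ennreal_power)
  also have "\<dots> = \<bar>s\<bar> ^ CARD('n) *\<^sub>R (\<integral>x. f (s *\<^sub>R x) \<partial>lborel)"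
    by (simp add: integral_density integral_distr)
  finally show ?thesis
    using \<open>s \<noteq> 0\<close> by (simp add: scaleR_conv_of_real)
qed

lemma integral_lborel_cong_except_0:
  fixes f g :: "real ^ 'n::finite \<Rightarrow> complex"
  assumes "\<And>x. x \<noteq> 0 \<Longrightarrow> f x = g x"
  shows "(\<integral>x. f x \<partial>lborel) = (\<integral>x. g x \<partial>lborel)"
  by (rule integral_discrete_difference[of "{0}"]) (use assms in auto)

lemma continuous_on_taylor_part: "continuous_on S (taylor_part k f)"
proof -
  have "continuous_on S (\<lambda>x. \<Prod>i\<leftarrow>is. x $ i)" for "is" and S :: "(real ^ 'n::finite) set"
    by (induction "is") (auto intro!: continuous_intros)
  then show ?thesis
    unfolding taylor_part_def[abs_def] by (intro continuous_intros) auto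
qed

lemma compact_subset_cball:
  fixes K :: "'a::real_normed_vector set"
  assumes "compact K" obtains \<rho> :: real where "1 \<le> \<rho>" "K \<subseteq> cball 0 \<rho>"
proof -
  obtain B where "\<And>x. x \<in> K \<Longrightarrow> norm x \<le> B"
    using compact_imp_bounded[OF assms] unfolding bounded_iff by blast
  then show thesis by (intro that[of "max 1 B"]) (auto simp: le_max_iff_disj)
qed

subsection \<open>Extension of a homogeneous function\<close>

locale homogeneous_symbol =
  fixes q :: "real ^ 'n::finite \<Rightarrow> complex" and d :: int
  assumes odd_dim: "odd CARD('n)"
    and smooth: "smooth_on (- {0}) q"
    and hom: "\<And>t x. t > 0 \<Longrightarrow> x \<noteq> 0 \<Longrightarrow> q (t *\<^sub>R x) = of_real (t powi d) * q x"
    and parity: "\<And>x. x \<noteq> 0 \<Longrightarrow> q (- x) = (-1) powi d * q x"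
begin

lemma continuous_on_q: "continuous_on (- {0}) q"
  using continuous_on_iter_partial[OF smooth, of "[]"] by simp

lemma borel_measurable_q [measurable]: "q \<in> borel_measurable borel"
  by (rule borel_measurable_continuous_countable_exceptions[OF _ continuous_on_q]) simp

text \<open>Compactness of the unit sphere bounds \<open>q\<close> there, and homogeneity carries
  the bound along the rays.\<close>

lemma q_bound: obtains M where "0 \<le> M" "\<And>x. x \<noteq> 0 \<Longrightarrow> norm (q x) \<le> M * norm x powi d"
proof -
  have "compact (q ` sphere 0 1)"
    by (intro compact_continuous_image continuous_on_subset[OF continuous_on_q]) auto
  then obtain M where M: "\<And>x. x \<in> sphere 0 1 \<Longrightarrow> norm (q x) \<le> M"
    unfolding compact_eq_bounded_closed bounded_iff by blast
  have "norm (q x) \<le> max 0 M * norm x powi d" if "x \<noteq> 0" for x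
  proof -
    let ?y = "inverse (norm x) *\<^sub>R x"
    have y: "?y \<in> sphere 0 1" "?y \<noteq> 0" using that by auto
    have "q x = q (norm x *\<^sub>R ?y)" using that by simp
    also have "\<dots> = of_real (norm x powi d) * q ?y"
      using that y by (intro hom) auto
    finally have "norm (q x) = norm x powi d * norm (q ?y)"
      by (simp add: norm_mult norm_power_int)
    also have "\<dots> \<le> norm x powi d * max 0 M"
      using M[OF y(1)] by (intro mult_left_mono) auto
    finally show ?thesis by (simp add: mult_ac)
  qed
  then show thesis using that[of "max 0 M"] by simp
qed

text \<open>The truncation by \<open>nat\<close> means that nothing is subtracted when
  \<open>d \<ge> - n\<close>. For \<open>d > - n\<close> the symbol is locally integrable; at
  \<open>d = - n\<close> the constant term cancels by symmetrisation.\<close>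

definition taylor_order :: nat where "taylor_order = nat (- d - int CARD('n))"

definition taylor_rem :: "(real ^ 'n \<Rightarrow> complex) \<Rightarrow> real ^ 'n \<Rightarrow> complex" where
  "taylor_rem f x = f x - (\<Sum>k<taylor_order. taylor_part k f x)"

text \<open>This is the projection of the remainder onto functions with the parity of
  \<open>q\<close>.\<close>

definition sym_rem :: "(real ^ 'n \<Rightarrow> complex) \<Rightarrow> real ^ 'n \<Rightarrow> complex" where
  "sym_rem f x = (taylor_rem f x + (-1) powi d * taylor_rem f (- x)) / 2"

definition extension :: "(real ^ 'n \<Rightarrow> complex) \<Rightarrow> complex" where
  "extension = (\<lambda>f\<in>test_functions UNIV. \<integral>x. q x * sym_rem f x \<partial>lborel)"

lemma norm_sign: "norm ((-1 :: complex) powi d) = 1"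
  by (simp add: norm_power_int)

lemma norm_sym_le:
  fixes a b :: complex
  assumes "norm a \<le> B" "norm b \<le> B"
  shows "norm ((a + (-1) powi d * b) / 2) \<le> B"
proof -
  have "norm (a + (-1) powi d * b) \<le> norm a + norm ((-1) powi d * b)"
    by (rule norm_triangle_ineq)
  also have "\<dots> \<le> 2 * B"
    using assms by (simp add: norm_mult norm_sign)
  finally show ?thesis by (simp add: norm_divide)
qed

text \<open>
  Here the parity hypotheses enter: the Taylor part of order \<open>- d - n\<close>, which would produce a
  logarithmic divergence, cancels.
\<close>

lemma sym_rem_eq_higher_order:
  assumes "d + int CARD('n) \<le> 0"
  shows "sym_rem f x = ((f x - (\<Sum>k<Suc taylor_order. taylor_part k f x)) +
    (-1) powi d * (f (- x) - (\<Sum>k<Suc taylor_order. taylor_part k f (- x)))) / 2"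
proof -
  have "int taylor_order = - (d + int CARD('n))" using assms by (simp add: taylor_order_def)
  then have "even (int taylor_order) \<longleftrightarrow> odd d" using odd_dim by simp
  then have "(-1 :: complex) powi d * (-1) ^ taylor_order = -1"
    by (cases "even d") (auto simp: power_int_minus_left)
  then have "taylor_part taylor_order f x + (-1) powi d * taylor_part taylor_order f (- x) = 0"
    using taylor_part_scaleR[of taylor_order f "-1" x] by (simp add: mult.assoc[symmetric])
  moreover have "(f x - (\<Sum>k<Suc taylor_order. taylor_part k f x)) +
      (-1) powi d * (f (- x) - (\<Sum>k<Suc taylor_order. taylor_part k f (- x))) =
      taylor_rem f x + (-1) powi d * taylor_rem f (- x)
      - (taylor_part taylor_order f x + (-1) powi d * taylor_part taylor_order f (- x))"
    unfolding taylor_rem_def sum.lessThan_Suc by (simp only: algebra_simps)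
  ultimately show ?thesis
    unfolding sym_rem_def by simp
qed

section \<open>Estimates of the integrand\<close>

text \<open>If \<open>d \<le> - n\<close>, the gained order gives the exponent
  \<open>taylor_order + 1 + d = 1 - n\<close>. Otherwise nothing is subtracted, the remainder is
  bounded, and \<open>d \<ge> 1 - n\<close> suffices on the unit ball.\<close>

lemma sym_rem_bound_inside:
  assumes f: "f \<in> test_functions UNIV" and x: "x \<noteq> 0" "norm x \<le> 1"
  shows "norm (sym_rem f x) * norm x powi d
    \<le> real CARD('n) ^ Suc taylor_order * Ck_seminorm (Suc taylor_order) f * majorant x"
proof (cases "d + int CARD('n) \<le> 0")
  case True
  let ?S = "Ck_seminorm (Suc taylor_order) f" and ?n = "real CARD('n)"
  let ?r = "\<lambda>x. f x - (\<Sum>k<Suc taylor_order. taylor_part k f x)"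
  have r: "norm (?r y) \<le> ?n ^ Suc taylor_order * ?S * norm y ^ Suc taylor_order" for y
    using f by (intro taylor_remainder_bound iter_partial_le_Ck_seminorm) (auto simp: test_functions_def)
  have "norm (sym_rem f x) \<le> ?n ^ Suc taylor_order * ?S * norm x ^ Suc taylor_order"
    unfolding sym_rem_eq_higher_order[OF True] using r[of x] r[of "- x"]
    by (intro norm_sym_le) (simp_all only: norm_minus_cancel)
  then have "norm (sym_rem f x) * norm x powi d \<le> ?n ^ Suc taylor_order * ?S * norm x ^ Suc taylor_order * norm x powi d"
    by (intro mult_right_mono) auto
  also have "\<dots> = ?n ^ Suc taylor_order * ?S * (norm x powi (int (Suc taylor_order) + d))"
    using x by (simp only: power_int_add norm_eq_zero power_int_of_nat mult.assoc not_False_eq_True simp_thms)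
  also have "int (Suc taylor_order) + d = 1 - int CARD('n)"
    using True by (simp add: taylor_order_def)
  finally show ?thesis using x by (simp add: majorant_def)
next
  case False
  let ?S = "Ck_seminorm (Suc taylor_order) f" and ?n = "real CARD('n)"
  have n: "?n \<ge> 1" using zero_less_card_finite[where 'a = 'n] by linarith
  have S: "?S \<ge> 0" by (rule Ck_seminorm_nonneg[OF f])
  have "taylor_order = 0" using False by (simp add: taylor_order_def)
  then have "norm (sym_rem f x) \<le> ?S"
    unfolding sym_rem_def taylor_rem_def using iter_partial_le_Ck_seminorm[OF f, of "[]" "Suc taylor_order"]
    by (intro norm_sym_le) simp_all
  moreover have "norm x powi d \<le> majorant x"
    using False x by (simp add: majorant_def power_int_decreasing)
  ultimately have "norm (sym_rem f x) * norm x powi d \<le> ?S * majorant x"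
    using S by (intro mult_mono) auto
  also have "\<dots> \<le> (?n ^ Suc taylor_order * ?S) * majorant x"
    using mult_right_mono[OF one_le_power[OF n, of "Suc taylor_order"] S]
    by (intro mult_right_mono majorant_nonneg) auto
  finally show ?thesis .
qed

text \<open>The function itself contributes only on the ball of radius \<open>\<rho>\<close>, where
  any two powers of the norm are comparable. The Taylor polynomial has degree at most
  \<open>taylor_order - 1\<close>, and \<open>taylor_order - 1 + d = - n - 1\<close> is the decay of
  the majorant.\<close>

lemma rem_bound_outside:
  assumes f: "f \<in> test_functions UNIV" and \<rho>: "supp f \<subseteq> cball 0 \<rho>" "1 \<le> \<rho>" and x: "norm x > 1"
  shows "norm (taylor_rem f x) * norm x powi d
    \<le> (\<rho> ^ nat \<bar>d + int CARD('n) + 1\<bar> + taylor_order * real CARD('n) ^ Suc taylor_order) * Ck_seminorm (Suc taylor_order) f * majorant x"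
proof -
  let ?S = "Ck_seminorm (Suc taylor_order) f" and ?n = "real CARD('n)" and ?L = "nat \<bar>d + int CARD('n) + 1\<bar>"
  have n: "?n \<ge> 1" using zero_less_card_finite[where 'a = 'n] by linarith
  have S: "?S \<ge> 0" by (rule Ck_seminorm_nonneg[OF f])
  have ker: "majorant x = norm x powi (- int CARD('n) - 1)" using x by (simp add: majorant_def)
  have x0: "norm x \<noteq> 0" using x by linarith
  have "norm (f x) * norm x powi d \<le> \<rho> ^ ?L * ?S * majorant x"
  proof (cases "norm x \<le> \<rho>")
    case True
    have "norm x powi d = norm x powi (d + int CARD('n) + 1) * majorant x"
      using x0 by (simp add: ker flip: power_int_add)
    \<comment> \<open>The sign of the exponent \<open>d + n + 1\<close> is unknown; as
      \<open>norm x > 1\<close>, passing to its absolute value only enlarges the power.\<close>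
    also have "norm x powi (d + int CARD('n) + 1) \<le> norm x powi int ?L"
      using x by (intro power_int_increasing) auto
    also have "\<dots> \<le> \<rho> ^ ?L"
      using True by (simp only: power_int_of_nat) (intro power_mono, auto)
    finally have "norm x powi d \<le> \<rho> ^ ?L * majorant x"
      using majorant_nonneg[of x] by (simp add: mult_right_mono)
    moreover have "norm (f x) \<le> ?S"
      using iter_partial_le_Ck_seminorm[OF f, of "[]" "Suc taylor_order" x] by simp
    ultimately have "norm (f x) * norm x powi d \<le> ?S * (\<rho> ^ ?L * majorant x)"
      using S by (intro mult_mono) auto
    then show ?thesis by (simp add: mult_ac)
  next
    case False
    then have "x \<notin> supp f" using \<rho>(1) by auto
    then have "f x = 0"
      using iter_partial_outside_supp[of x f "[]"] by simp
    then show ?thesis using S \<rho>(2) majorant_nonneg[of x] by simp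
  qed
  moreover have "norm (\<Sum>k<taylor_order. taylor_part k f x) * norm x powi d \<le> taylor_order * ?n ^ Suc taylor_order * ?S * majorant x"
  proof (cases "taylor_order = 0")
    case False
    have "norm (taylor_part k f x) \<le> ?n ^ Suc taylor_order * ?S * norm x ^ (taylor_order - 1)" if "k < taylor_order" for k
    proof -
      have "norm (taylor_part k f x) \<le> ?n ^ k * ?S * norm x ^ k"
        using that by (intro taylor_part_bound iter_partial_le_Ck_seminorm[OF f]) auto
      also have "\<dots> \<le> ?n ^ Suc taylor_order * ?S * norm x ^ (taylor_order - 1)"
        using that x n S by (intro mult_mono power_increasing) auto
      finally show ?thesis .
    qed
    then have "norm (\<Sum>k<taylor_order. taylor_part k f x) \<le> of_nat (card {..<taylor_order}) * (?n ^ Suc taylor_order * ?S * norm x ^ (taylor_order - 1))"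
      by (intro sum_norm_bound) auto
    then have "norm (\<Sum>k<taylor_order. taylor_part k f x) * norm x powi d
        \<le> taylor_order * (?n ^ Suc taylor_order * ?S * norm x ^ (taylor_order - 1)) * norm x powi d"
      by (intro mult_right_mono) auto
    also have "\<dots> = taylor_order * ?n ^ Suc taylor_order * ?S * (norm x powi int (taylor_order - 1) * norm x powi d)"
      by (simp only: power_int_of_nat mult_ac)
    also have "norm x powi int (taylor_order - 1) * norm x powi d = norm x powi (int (taylor_order - 1) + d)"
      using x0 by (simp only: power_int_add simp_thms)
    also have "int (taylor_order - 1) + d = - int CARD('n) - 1"
      using False by (auto simp: taylor_order_def)
    finally show ?thesis by (simp add: ker)
  qed simp
  moreover have "norm (taylor_rem f x) * norm x powi d \<le>
      (norm (f x) + norm (\<Sum>k<taylor_order. taylor_part k f x)) * norm x powi d"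
    unfolding taylor_rem_def by (intro mult_right_mono norm_triangle_ineq4) auto
  ultimately show ?thesis by (simp add: distrib_right)
qed

text \<open>The constant depends on \<open>\<rho>\<close> but not on \<open>f\<close>, so the same
  estimate yields absolute convergence and the continuity of the functional.\<close>

lemma integrand_bound:
  assumes "1 \<le> \<rho>"
  obtains A where "0 \<le> A" "\<And>f x. f \<in> test_functions UNIV \<Longrightarrow> supp f \<subseteq> cball 0 \<rho> \<Longrightarrow> x \<noteq> 0 \<Longrightarrow>
    norm (q x * sym_rem f x) \<le> A * Ck_seminorm (Suc taylor_order) f * majorant x"
proof -
  obtain M where M: "0 \<le> M" "\<And>x. x \<noteq> 0 \<Longrightarrow> norm (q x) \<le> M * norm x powi d"
    using q_bound by blast
  define D1 where "D1 = real CARD('n) ^ Suc taylor_order"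
  define D2 where "D2 = \<rho> ^ nat \<bar>d + int CARD('n) + 1\<bar> + taylor_order * real CARD('n) ^ Suc taylor_order"
  have D: "0 \<le> D1" "0 \<le> D2" using assms by (auto simp: D1_def D2_def)
  show thesis
  proof (rule that)
    show "0 \<le> M * (D1 + D2)" using M D by simp
    fix f :: "real ^ 'n \<Rightarrow> complex" and x assume f: "f \<in> test_functions UNIV" "supp f \<subseteq> cball 0 \<rho>" and x: "x \<noteq> (0 :: real ^ 'n)"
    let ?S = "Ck_seminorm (Suc taylor_order) f"
    have S: "?S \<ge> 0" by (rule Ck_seminorm_nonneg[OF f(1)])
    have "norm (sym_rem f x) * norm x powi d \<le> (D1 + D2) * ?S * majorant x"
    proof (cases "norm x \<le> 1")
      case True
      have "norm (sym_rem f x) * norm x powi d \<le> D1 * ?S * majorant x"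
        unfolding D1_def by (rule sym_rem_bound_inside[OF f(1) x True])
      also have "\<dots> \<le> (D1 + D2) * ?S * majorant x"
        using D S majorant_nonneg by (intro mult_right_mono) auto
      finally show ?thesis .
    next
      case False
      then have pos: "norm x powi d > 0" using x by simp
      \<comment> \<open>The symmetrised remainder involves both \<open>x\<close> and
        \<open>- x\<close>; norm and majorant agree at the two points.\<close>
      have "norm (taylor_rem f y) \<le> D2 * ?S * majorant x / norm x powi d" if "y = x \<or> y = - x" for y
        using rem_bound_outside[OF f assms, of y] False that pos
        by (auto simp: D2_def pos_le_divide_eq majorant_def)
      then have "norm (sym_rem f x) \<le> D2 * ?S * majorant x / norm x powi d"
        unfolding sym_rem_def by (intro norm_sym_le) auto
      then have "norm (sym_rem f x) * norm x powi d \<le> D2 * ?S * majorant x"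
        using pos by (simp add: pos_le_divide_eq)
      also have "\<dots> \<le> (D1 + D2) * ?S * majorant x"
        using D S majorant_nonneg by (intro mult_right_mono) auto
      finally show ?thesis .
    qed
    then have "M * (norm (sym_rem f x) * norm x powi d) \<le> M * ((D1 + D2) * ?S * majorant x)"
      using M by (intro mult_left_mono) auto
    moreover have "norm (q x * sym_rem f x) \<le> M * norm x powi d * norm (sym_rem f x)"
      unfolding norm_mult using M(2)[OF x] by (intro mult_right_mono) auto
    ultimately show "norm (q x * sym_rem f x) \<le> M * (D1 + D2) * ?S * majorant x"
      by (simp add: mult_ac)
  qed
qed

lemma continuous_on_rem: "f \<in> test_functions UNIV \<Longrightarrow> continuous_on UNIV (taylor_rem f)"
  unfolding taylor_rem_def[abs_def] using continuous_on_iter_partial[of UNIV f "[]"]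
  by (intro continuous_intros continuous_on_taylor_part) (auto simp: test_functions_def)

lemma borel_measurable_sym_rem:
  assumes "f \<in> test_functions UNIV" shows "sym_rem f \<in> borel_measurable borel"
proof -
  have [measurable]: "taylor_rem f \<in> borel_measurable borel"
    by (rule borel_measurable_continuous_onI[OF continuous_on_rem[OF assms]])
  show ?thesis unfolding sym_rem_def[abs_def] by measurable
qed

lemma integrable_integrand:
  assumes f: "f \<in> test_functions UNIV"
  shows "integrable lborel (\<lambda>x. q x * sym_rem f x)"
proof -
  have [measurable]: "sym_rem f \<in> borel_measurable borel" by (rule borel_measurable_sym_rem[OF f])
  obtain \<rho> where \<rho>: "1 \<le> \<rho>" "supp f \<subseteq> cball 0 \<rho>"
    using compact_subset_cball[of "supp f"] f by (auto simp: test_functions_def)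
  obtain A where "0 \<le> A" and A: "\<And>f x. f \<in> test_functions UNIV \<Longrightarrow> supp f \<subseteq> cball 0 \<rho> \<Longrightarrow> x \<noteq> 0 \<Longrightarrow>
    norm (q x * sym_rem f x) \<le> A * Ck_seminorm (Suc taylor_order) f * majorant x"
    using integrand_bound[OF \<rho>(1)] by blast
  show ?thesis
  proof (rule Bochner_Integration.integrable_bound)
    show "integrable lborel (\<lambda>x :: real ^ 'n. A * Ck_seminorm (Suc taylor_order) f * majorant x)"
      by (intro integrable_mult_right integrable_majorant)
    show "AE x in lborel. norm (q x * sym_rem f x) \<le> norm (A * Ck_seminorm (Suc taylor_order) f * majorant x)"
      using AE_lborel_singleton[of "0 :: real ^ 'n"]
    proof eventually_elim
      case (elim x)
      then show ?case using A[OF f \<rho>(2), of x] by (auto intro: order_trans[OF _ abs_ge_self])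
    qed
  qed measurable
qed

section \<open>Properties of the extension\<close>

lemma extension_eq: "f \<in> test_functions UNIV \<Longrightarrow> extension f = (\<integral>x. q x * sym_rem f x \<partial>lborel)"
  by (simp add: extension_def)

lemma sym_rem_add:
  assumes "f \<in> test_functions UNIV" "g \<in> test_functions UNIV"
  shows "sym_rem (\<lambda>x. f x + g x) x = sym_rem f x + sym_rem g x"
proof -
  have "taylor_rem (\<lambda>x. f x + g x) y = taylor_rem f y + taylor_rem g y" for y
    using assms by (simp add: taylor_rem_def test_functions_def taylor_part_add sum.distrib)
  then show ?thesis
    by (simp add: sym_rem_def distrib_left add_divide_distrib)
qed

lemma sym_rem_cmult:
  assumes "f \<in> test_functions UNIV"
  shows "sym_rem (\<lambda>x. c * f x) x = c * sym_rem f x"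
proof -
  have "taylor_rem (\<lambda>x. c * f x) y = c * taylor_rem f y" for y
    using assms
    by (simp add: taylor_rem_def test_functions_def taylor_part_cmult right_diff_distrib sum_distrib_left)
  then show ?thesis
    by (simp add: sym_rem_def distrib_left mult_ac)
qed

lemma sym_rem_dilate:
  "f \<in> test_functions UNIV \<Longrightarrow> sym_rem (\<lambda>x. f (s *\<^sub>R x)) x = sym_rem f (s *\<^sub>R x)"
  unfolding sym_rem_def taylor_rem_def test_functions_def by (simp add: taylor_part_dilate)

lemma distribution_extension: "distribution extension"
  unfolding distribution_def
proof (intro conjI ballI allI impI)
  show "extension \<in> extensional (test_functions UNIV)"
    by (simp add: extension_def)
next
  fix f g :: "real ^ 'n \<Rightarrow> complex" assume "f \<in> test_functions UNIV" "g \<in> test_functions UNIV"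
  then show "extension (\<lambda>x. f x + g x) = extension f + extension g"
    by (simp add: extension_eq test_functions_add sym_rem_add distrib_left integrable_integrand)
next
  fix f :: "real ^ 'n \<Rightarrow> complex" and c assume "f \<in> test_functions UNIV"
  then show "extension (\<lambda>x. c * f x) = c * extension f"
    by (simp add: extension_eq test_functions_cmult sym_rem_cmult mult.left_commute[of _ c])
next
  fix K :: "(real ^ 'n) set" assume "compact K"
  then obtain \<rho> where \<rho>: "1 \<le> \<rho>" "K \<subseteq> cball 0 \<rho>" using compact_subset_cball by blast
  obtain A where "0 \<le> A" and A: "\<And>f x. f \<in> test_functions UNIV \<Longrightarrow> supp f \<subseteq> cball 0 \<rho> \<Longrightarrow> x \<noteq> 0 \<Longrightarrow>
    norm (q x * sym_rem f x) \<le> A * Ck_seminorm (Suc taylor_order) f * majorant x"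
    using integrand_bound[OF \<rho>(1)] by blast
  have "norm (extension f) \<le> A * integral\<^sup>L lborel (majorant :: real ^ 'n \<Rightarrow> real) * Ck_seminorm (Suc taylor_order) f"
    if f: "f \<in> test_functions UNIV" "supp f \<subseteq> K" for f
  proof -
    have "norm (extension f) \<le> (\<integral>x. A * Ck_seminorm (Suc taylor_order) f * majorant (x :: real ^ 'n) \<partial>lborel)"
      unfolding extension_eq[OF f(1)]
    proof (rule order_trans[OF integral_norm_bound integral_mono_AE])
      show "integrable lborel (\<lambda>x :: real ^ 'n. A * Ck_seminorm (Suc taylor_order) f * majorant x)"
        by (intro integrable_mult_right integrable_majorant)
      show "AE x in lborel. norm (q x * sym_rem f x) \<le> A * Ck_seminorm (Suc taylor_order) f * majorant x"
        using AE_lborel_singleton[of "0 :: real ^ 'n"]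
        by eventually_elim (use A[OF f(1)] f(2) \<rho>(2) in auto)
    qed (rule integrable_norm[OF integrable_integrand[OF f(1)]])
    then show ?thesis by (simp add: mult_ac)
  qed
  then show "\<exists>C N. \<forall>f\<in>test_functions UNIV. supp f \<subseteq> K \<longrightarrow> norm (extension f) \<le> C * Ck_seminorm N f"
    by blast
qed

text \<open>Homogeneity is the case \<open>s = inverse t\<close> and regular parity the case
  \<open>s = -1\<close>, with \<open>c\<close> the factor that \<open>q\<close> acquires.\<close>

lemma extension_dilate:
  assumes f: "f \<in> test_functions UNIV" and s: "s \<noteq> 0"
    and c: "\<And>x. x \<noteq> 0 \<Longrightarrow> q (inverse s *\<^sub>R x) = c * q x"
  shows "extension (\<lambda>x. f (s *\<^sub>R x)) = c * extension f / of_real (\<bar>s\<bar> ^ CARD('n))"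
proof -
  have [measurable]: "sym_rem f \<in> borel_measurable borel" by (rule borel_measurable_sym_rem[OF f])
  have "extension (\<lambda>x. f (s *\<^sub>R x)) = (\<integral>x. q x * sym_rem f (s *\<^sub>R x) \<partial>lborel)"
    using f s by (simp add: extension_eq test_functions_dilate sym_rem_dilate)
  \<comment> \<open>Rewriting the argument of \<open>q\<close> makes the whole integrand a function
    of \<open>s *\<^sub>R x\<close>, ready for the change of variables.\<close>
  also have "\<dots> = (\<integral>x. q (inverse s *\<^sub>R (s *\<^sub>R x)) * sym_rem f (s *\<^sub>R x) \<partial>lborel)"
    using s by simp
  also have "\<dots> = (\<integral>x. q (inverse s *\<^sub>R x) * sym_rem f x \<partial>lborel) / of_real (\<bar>s\<bar> ^ CARD('n))"
    by (rule integral_lborel_dilate[OF _ s]) measurable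
  also have "(\<integral>x. q (inverse s *\<^sub>R x) * sym_rem f x \<partial>lborel) = (\<integral>x. c * (q x * sym_rem f x) \<partial>lborel)"
    by (rule integral_lborel_cong_except_0) (simp add: c)
  also have "\<dots> = c * extension f"
    using f by (simp add: extension_eq)
  finally show ?thesis .
qed

lemma homogeneous_extension: "homogeneous_dist d extension"
  unfolding homogeneous_dist_def dist_dilate_def
proof (intro allI impI ballI)
  fix t :: real and f :: "real ^ 'n \<Rightarrow> complex" assume t: "t > 0" and f: "f \<in> test_functions UNIV"
  have "extension (\<lambda>x. f (inverse t *\<^sub>R x)) = of_real (t powi d) * extension f / of_real (\<bar>inverse t\<bar> ^ CARD('n))"
    by (rule extension_dilate[OF f]) (use t hom in auto)
  then show "extension (\<lambda>\<xi>. f (inverse t *\<^sub>R \<xi>)) / of_real (\<bar>t\<bar> ^ CARD('n)) = of_real (t powi d) * extension f"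
    using t by (simp add: power_inverse)
qed

lemma regular_parity_extension: "regular_parity d extension"
  unfolding regular_parity_def dist_dilate_def
proof
  fix f :: "real ^ 'n \<Rightarrow> complex" assume f: "f \<in> test_functions UNIV"
  have "extension (\<lambda>x. f (inverse (-1) *\<^sub>R x)) = (-1) powi d * extension f / of_real (\<bar>inverse (-1)\<bar> ^ CARD('n))"
    by (rule extension_dilate[OF f]) (use parity in auto)
  then show "extension (\<lambda>\<xi>. f (inverse (- 1) *\<^sub>R \<xi>)) / of_real (\<bar>- 1\<bar> ^ CARD('n)) = (- 1) powi d * extension f"
    by simp
qed

text \<open>A test function supported away from \<open>0\<close> has vanishing Taylor parts. The
  symmetrisation is then undone by reflecting the second half of the integral, since
  \<open>q\<close> has the matching parity.\<close>

lemma extension_equals_q: "dist_equals_on (- {0}) extension q"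
  unfolding dist_equals_on_def
proof
  fix f :: "real ^ 'n \<Rightarrow> complex" assume f0: "f \<in> test_functions (- {0})"
  then have f: "f \<in> test_functions UNIV" and supp: "compact (supp f)" "supp f \<subseteq> - {0}"
    by (auto simp: test_functions_def)
  have cont: "continuous_on UNIV f"
    using f continuous_on_iter_partial[of UNIV f "[]"] by (simp add: test_functions_def)
  then have [measurable]: "f \<in> borel_measurable borel"
    by (rule borel_measurable_continuous_onI)
  have "taylor_part k f x = 0" for k x
    using iter_partial_outside_supp[of 0 f] supp(2) by (auto simp: taylor_part_def)
  then have sym: "sym_rem f x = (f x + (-1) powi d * f (- x)) / 2" for x
    by (simp add: sym_rem_def taylor_rem_def)
  have "integrable lborel (\<lambda>x. indicator (supp f) x *\<^sub>R (q x * f x))"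
    using supp by (intro borel_integrable_compact continuous_intros
        continuous_on_subset[OF continuous_on_q] continuous_on_subset[OF cont]) auto
  moreover have "indicator (supp f) x *\<^sub>R (q x * f x) = q x * f x" for x
    using iter_partial_outside_supp[of x f "[]"] by (cases "x \<in> supp f") auto
  ultimately have int1: "integrable lborel (\<lambda>x. q x * f x)" by simp
  \<comment> \<open>The change of variables above transports values of integrals only, so
    integrability of the reflected term is obtained from a difference of two integrable
    functions.\<close>
  have "2 * (q x * sym_rem f x) - q x * f x = (-1) powi d * q x * f (- x)" for x
    by (simp add: sym field_simps)
  moreover have "integrable lborel (\<lambda>x. 2 * (q x * sym_rem f x) - q x * f x)"
    by (intro Bochner_Integration.integrable_diff integrable_mult_right integrable_integrand f int1)
  ultimately have int2: "integrable lborel (\<lambda>x. (-1) powi d * q x * f (- x))"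
    by simp
  have "(\<integral>x. (-1) powi d * q x * f (- x) \<partial>lborel) = (\<integral>x. q ((-1) *\<^sub>R x) * f ((-1) *\<^sub>R x) \<partial>lborel)"
    by (rule integral_lborel_cong_except_0) (simp add: parity)
  also have "\<dots> = (\<integral>x. q x * f x \<partial>lborel)"
    using integral_lborel_dilate[of "\<lambda>x. q x * f x" "-1"] by simp
  finally have eq: "(\<integral>x. (-1) powi d * q x * f (- x) \<partial>lborel) = (\<integral>x. q x * f x \<partial>lborel)" .
  have "extension f = (\<integral>x. (q x * f x + (-1) powi d * q x * f (- x)) / 2 \<partial>lborel)"
    unfolding extension_eq[OF f] sym by (simp add: algebra_simps)
  also have "\<dots> = ((\<integral>x. q x * f x \<partial>lborel) + (\<integral>x. (-1) powi d * q x * f (- x) \<partial>lborel)) / 2"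
    using Bochner_Integration.integral_add[OF int1 int2] by simp
  finally show "extension f = (\<integral>x. q x * f x \<partial>lborel)"
    using eq by simp
qed

end

subsection \<open>Existence and uniqueness\<close>

lemma homogeneous_regular_parity_unique:
  fixes u w :: "(real ^ 'n::finite \<Rightarrow> complex) \<Rightarrow> complex"
  assumes "odd CARD('n)"
    and u: "distribution u" "homogeneous_dist d u" "regular_parity d u" "dist_equals_on (- {0}) u q"
    and w: "distribution w" "homogeneous_dist d w" "regular_parity d w" "dist_equals_on (- {0}) w q"
  shows "u = w"
proof (rule extensionalityI)
  show "u \<in> extensional (test_functions UNIV)" "w \<in> extensional (test_functions UNIV)"
    using u(1) w(1) by (simp_all add: distribution_def)
  fix f :: "real ^ 'n \<Rightarrow> complex" assume f: "f \<in> test_functions UNIV"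
  \<comment> \<open>The radius \<open>2\<close> is the one for which the lemma on the origin asks
    for a continuity estimate, coming from the support of the cutoff.\<close>
  define K where "K = cball (0 :: real ^ 'n) 2"
  have "compact K" by (simp add: K_def)
  obtain C1 N1 where 1: "\<And>f. f \<in> test_functions UNIV \<Longrightarrow> supp f \<subseteq> K \<Longrightarrow> norm (u f) \<le> C1 * Ck_seminorm N1 f"
    using u(1) \<open>compact K\<close> unfolding distribution_def by meson
  obtain C2 N2 where 2: "\<And>f. f \<in> test_functions UNIV \<Longrightarrow> supp f \<subseteq> K \<Longrightarrow> norm (w f) \<le> C2 * Ck_seminorm N2 f"
    using w(1) \<open>compact K\<close> unfolding distribution_def by meson
  \<comment> \<open>Homogeneity, applied at \<open>inverse t\<close> and solved for the dilated test
    function, combines the degree and the Jacobian into the exponent \<open>- d - n\<close>.\<close>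
  have dilate: "v (\<lambda>x. f (t *\<^sub>R x)) = of_real (t powi (- d - int CARD('n))) * v f"
    if "homogeneous_dist d v" "t > 0" "f \<in> test_functions UNIV" for v :: "(real ^ 'n \<Rightarrow> complex) \<Rightarrow> complex" and t f
  proof -
    have "v (\<lambda>x. f (t *\<^sub>R x)) / complex_of_real (inverse t ^ CARD('n)) = of_real (inverse t powi d) * v f"
      using that(1)[unfolded homogeneous_dist_def dist_dilate_def, rule_format, of "inverse t" f] that by simp
    moreover have "t powi (- d - int CARD('n)) = inverse t powi d * inverse t ^ CARD('n)"
      using that(2) by (simp add: power_int_diff power_int_minus power_int_inverse power_inverse divide_inverse)
    moreover have "complex_of_real (inverse t ^ CARD('n)) \<noteq> 0"
      using that(2) by simp
    ultimately show ?thesis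
      by (simp only: of_real_mult divide_eq_eq if_True not_False_eq_True mult_ac)
  qed
  have reflect: "v (\<lambda>x. f ((-1) *\<^sub>R x)) = (-1) powi d * v f"
    if "regular_parity d v" "f \<in> test_functions UNIV" for v :: "(real ^ 'n \<Rightarrow> complex) \<Rightarrow> complex" and f
    using that by (simp add: regular_parity_def dist_dilate_def)
  have "u f - w f = 0"
  proof (rule homogeneous_regular_parity_supported_at_0[where v = "\<lambda>f. u f - w f" and d = d
        and C = "\<bar>C1\<bar> + \<bar>C2\<bar>" and N = "max N1 N2", OF \<open>odd CARD('n)\<close>])
    fix f g :: "real ^ 'n \<Rightarrow> complex" assume "f \<in> test_functions UNIV" "g \<in> test_functions UNIV"
    then show "u (\<lambda>x. f x + g x) - w (\<lambda>x. f x + g x) = u f - w f + (u g - w g)"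
      using u(1) w(1) by (simp add: distribution_def)
  next
    fix f :: "real ^ 'n \<Rightarrow> complex" and c assume "f \<in> test_functions UNIV"
    then show "u (\<lambda>x. c * f x) - w (\<lambda>x. c * f x) = c * (u f - w f)"
      using u(1) w(1) by (simp add: distribution_def right_diff_distrib)
  next
    fix f :: "real ^ 'n \<Rightarrow> complex" assume f: "f \<in> test_functions UNIV" "supp f \<subseteq> cball 0 2"
    have *: "C * Ck_seminorm N f \<le> \<bar>C\<bar> * Ck_seminorm (max N1 N2) f" if "N \<le> max N1 N2" for C N
      using that Ck_seminorm_nonneg[OF f(1), of N] by (intro mult_mono Ck_seminorm_mono[OF f(1)]) auto
    have "norm (u f - w f) \<le> norm (u f) + norm (w f)" by (rule norm_triangle_ineq4)
    also have "\<dots> \<le> C1 * Ck_seminorm N1 f + C2 * Ck_seminorm N2 f"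
      using 1[of f] 2[of f] f by (simp add: K_def)
    also have "\<dots> \<le> (\<bar>C1\<bar> + \<bar>C2\<bar>) * Ck_seminorm (max N1 N2) f"
      using *[of N1 C1] *[of N2 C2] by (simp add: distrib_right)
    finally show "norm (u f - w f) \<le> (\<bar>C1\<bar> + \<bar>C2\<bar>) * Ck_seminorm (max N1 N2) f" .
  next
    fix f :: "real ^ 'n \<Rightarrow> complex" assume "f \<in> test_functions (- {0})"
    then show "u f - w f = 0"
      using u(4) w(4) by (simp add: dist_equals_on_def)
  next
    fix f :: "real ^ 'n \<Rightarrow> complex" and t :: real assume "t > 0" "f \<in> test_functions UNIV"
    then show "u (\<lambda>x. f (t *\<^sub>R x)) - w (\<lambda>x. f (t *\<^sub>R x)) = of_real (t powi (- d - int CARD('n))) * (u f - w f)"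
      using dilate[OF u(2)] dilate[OF w(2)] by (simp add: right_diff_distrib)
  next
    fix f :: "real ^ 'n \<Rightarrow> complex" assume "f \<in> test_functions UNIV"
    then show "u (\<lambda>x. f ((-1) *\<^sub>R x)) - w (\<lambda>x. f ((-1) *\<^sub>R x)) = (-1) powi d * (u f - w f)"
      using reflect[OF u(3)] reflect[OF w(3)] by (simp add: right_diff_distrib)
  qed (rule f)
  then show "u f = w f" by simp
qed

theorem lemma1p2p5:
  fixes q :: "real ^ 'n::finite \<Rightarrow> complex" and d :: int
  assumes "odd CARD('n)"
    and "smooth_on (- {0}) q"
    and "\<And>t \<xi>. t > 0 \<Longrightarrow> \<xi> \<noteq> 0 \<Longrightarrow> q (t *\<^sub>R \<xi>) = of_real (t powi d) * q \<xi>"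
    and "\<And>\<xi>. \<xi> \<noteq> 0 \<Longrightarrow> q (- \<xi>) = (-1) powi d * q \<xi>"
  shows "\<exists>!u. distribution u \<and> homogeneous_dist d u \<and> regular_parity d u \<and>
           dist_equals_on (- {0}) u q"
proof -
  interpret homogeneous_symbol q d
    by unfold_locales (use assms in auto)
  show ?thesis
    using distribution_extension homogeneous_extension regular_parity_extension extension_equals_q
      homogeneous_regular_parity_unique[OF assms(1)]
    by (intro ex1I[of _ extension]) auto
qed

end
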